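(* Let $N\ge 1$ be an integer, $\alpha>0$ and $-\frac{\pi}{2}<\theta<\frac{\pi}{2}$. Let $u_0\in C_0(\mathbb{R}^N)\cap H^1(\mathbb{R}^N)$ and let $u\in C([0,T_{\max}), C_0(\mathbb{R}^N)\cap H^1(\mathbb{R}^N))$ be the corresponding maximal solution of $$e^{-i\theta}u_t=\Delta u+|u|^\alpha u,\qquad u(0)=u_0,$$ in $\mathbb{R}^N$. If $E(u_0)<0$, then $u$ blows up in finite time, i.e. $T_{\max}<\infty$. More precisely, $$T_{\max}\le \frac{\|u_0\|_{L^2}^2}{\alpha(\alpha+2)\,(-E(u_0))\cos\theta}.$$
   Context: All functions are complex-valued. $C_0(\mathbb{R}^N)$ is the space of continuous functions on $\mathbb{R}^N$ vanishing at infinity, with the sup norm. The energy is $$E(w)=\frac12\int_{\mathbb{R}^N}|\nabla w|^2-\frac{1}{\alpha+2}\int_{\mathbb{R}^N}|w|^{\alpha+2},\qquad w\in C_0(\mathbb{R}^N)\cap H^1(\mathbb{R}^N).$$ Maximal solution: for $-\pi/2<\theta<\pi/2$ and $u_0\in C_0(\mathbb{R}^N)\cap H^1(\mathbb{R}^N)$, the Cauchy problem is locally well posed: there exist $T>0$ and a unique $u\in C([0,T],C_0(\mathbb{R}^N)\cap H^1(\mathbb{R}^N))\cap C((0,T),H^2(\mathbb{R}^N))\cap C^1((0,T),L^2(\mathbb{R}^N))$ satisfying the equation for all $t\in(0,T)$ and $u(0)=u_0$. This $u$ extends to a maximal existence interval $[0,T_{\max})$ with $0<T_{\max}\le\infty$,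 and if $T_{\max}<\infty$ then $\|u(t)\|_{L^\infty}\to\infty$ as $t\uparrow T_{\max}$. *)

theory Defs
  imports "HOL-Analysis.Analysis"
begin

text \<open>
  Functions on Euclidean space are plain functions into \<^typ>\<open>complex\<close>, and elements of Lebesgue and
  Sobolev spaces are represented by Borel measurable functions.  Every Lebesgue class has such a
  representative, and none of the notions below depends on the choice of it.
\<close>

definition pderiv_dir :: "'a::euclidean_space \<Rightarrow> ('a \<Rightarrow> complex) \<Rightarrow> 'a \<Rightarrow> complex"
  where "pderiv_dir b f x = frechet_derivative f (at x) b"

primrec Ck :: "nat \<Rightarrow> ('a::euclidean_space \<Rightarrow> complex) \<Rightarrow> bool"
  where
    "Ck 0 f \<longleftrightarrow> continuous_on UNIV f"
  | "Ck (Suc k) f \<longleftrightarrow> (\<forall>x. f differentiable at x) \<and> (\<forall>b\<in>Basis. Ck k (pderiv_dir b f))"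

definition test_functions :: "('a::euclidean_space \<Rightarrow> complex) set"
  where "test_functions = {\<phi>. (\<forall>k. Ck k \<phi>) \<and> compact (closure {x. \<phi> x \<noteq> 0})}"

definition locally_integrable :: "('a::euclidean_space \<Rightarrow> complex) \<Rightarrow> bool"
  where "locally_integrable f \<longleftrightarrow> (\<forall>K. compact K \<longrightarrow> set_integrable lborel K f)"

definition has_weak_pderiv ::
    "'a::euclidean_space \<Rightarrow> ('a \<Rightarrow> complex) \<Rightarrow> ('a \<Rightarrow> complex) \<Rightarrow> bool"
  where "has_weak_pderiv b f g \<longleftrightarrow> locally_integrable f \<and> locally_integrable g \<and>
    (\<forall>\<phi>\<in>test_functions.
      (LINT x|lborel. f x * pderiv_dir b \<phi> x) = - (LINT x|lborel. g x * \<phi> x))"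

text \<open>A representative of the weak partial derivative, determined only almost everywhere.\<close>

definition weak_pderiv :: "'a::euclidean_space \<Rightarrow> ('a \<Rightarrow> complex) \<Rightarrow> 'a \<Rightarrow> complex"
  where "weak_pderiv b f = (SOME g. has_weak_pderiv b f g)"

definition weak_laplacian :: "('a::euclidean_space \<Rightarrow> complex) \<Rightarrow> 'a \<Rightarrow> complex"
  where "weak_laplacian f x = (\<Sum>b\<in>Basis. weak_pderiv b (weak_pderiv b f) x)"

definition C0_space :: "('a::euclidean_space \<Rightarrow> complex) set"
  where "C0_space = {f. continuous_on UNIV f \<and> (f \<longlongrightarrow> 0) at_infinity}"

definition L2_space :: "('a::euclidean_space \<Rightarrow> complex) set"
  where "L2_space =
    {f. f \<in> borel_measurable lborel \<and> integrable lborel (\<lambda>x. (cmod (f x))\<^sup>2)}"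

definition H1_space :: "('a::euclidean_space \<Rightarrow> complex) set"
  where "H1_space = {f\<in>L2_space. \<forall>b\<in>Basis. \<exists>g\<in>L2_space. has_weak_pderiv b f g}"

definition H2_space :: "('a::euclidean_space \<Rightarrow> complex) set"
  where "H2_space = {f\<in>H1_space. \<forall>b\<in>Basis. \<exists>g\<in>H1_space. has_weak_pderiv b f g}"

text \<open>The following norms are meaningful only on the respective spaces.\<close>

definition sup_norm :: "('a::euclidean_space \<Rightarrow> complex) \<Rightarrow> real"
  where "sup_norm f = (SUP x. cmod (f x))"

definition L2_norm :: "('a::euclidean_space \<Rightarrow> complex) \<Rightarrow> real"
  where "L2_norm f = sqrt (LINT x|lborel. (cmod (f x))\<^sup>2)"

definition H1_norm :: "('a::euclidean_space \<Rightarrow> complex) \<Rightarrow> real"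
  where "H1_norm f = sqrt ((L2_norm f)\<^sup>2 + (\<Sum>b\<in>Basis. (L2_norm (weak_pderiv b f))\<^sup>2))"

definition H2_norm :: "('a::euclidean_space \<Rightarrow> complex) \<Rightarrow> real"
  where "H2_norm f = sqrt ((H1_norm f)\<^sup>2 +
    (\<Sum>b\<in>Basis. \<Sum>c\<in>Basis. (L2_norm (weak_pderiv c (weak_pderiv b f)))\<^sup>2))"

definition energy :: "real \<Rightarrow> ('a::euclidean_space \<Rightarrow> complex) \<Rightarrow> real"
  where "energy \<alpha> w =
    1 / 2 * (LINT x|lborel. (\<Sum>b\<in>Basis. (cmod (weak_pderiv b w x))\<^sup>2))
    - 1 / (\<alpha> + 2) * (LINT x|lborel. cmod (w x) powr (\<alpha> + 2))"

text \<open>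
  \<open>C_in J X nrm u\<close> states \<open>u \<in> C(J, X)\<close>, where the function space \<open>X\<close> carries the norm \<open>nrm\<close>;
  \<open>has_L2_deriv u v t\<close> states that \<open>v\<close> is the derivative of \<open>u\<close> at the interior time \<open>t\<close>, as a
  limit of difference quotients in \<open>L\<^sup>2\<close>.
\<close>

definition C_in ::
    "real set \<Rightarrow> ('a \<Rightarrow> complex) set \<Rightarrow> (('a \<Rightarrow> complex) \<Rightarrow> real) \<Rightarrow> (real \<Rightarrow> 'a \<Rightarrow> complex) \<Rightarrow> bool"
  where "C_in J X nrm u \<longleftrightarrow> (\<forall>t\<in>J. u t \<in> X) \<and>
    (\<forall>t\<in>J. ((\<lambda>s. nrm (\<lambda>x. u s x - u t x)) \<longlongrightarrow> 0) (at t within J))"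

definition has_L2_deriv ::
    "(real \<Rightarrow> 'a::euclidean_space \<Rightarrow> complex) \<Rightarrow> ('a \<Rightarrow> complex) \<Rightarrow> real \<Rightarrow> bool"
  where "has_L2_deriv u v t \<longleftrightarrow>
    ((\<lambda>s. L2_norm (\<lambda>x. (u s x - u t x) / of_real (s - t) - v x)) \<longlongrightarrow> 0) (at t)"

text \<open>
  Solutions of \<open>e\<^sup>-\<^sup>i\<^sup>\<theta> u\<^sub>t = \<Delta>u + |u|\<^sup>\<alpha> u\<close> on \<open>[0,T]\<close>.  The equation is an identity in \<open>L\<^sup>2\<close> at every
  time of \<open>(0,T)\<close>, with \<open>v\<close> the time derivative of \<open>u\<close>.
\<close>

definition solution_on ::
    "real \<Rightarrow> real \<Rightarrow> ('a::euclidean_space \<Rightarrow> complex) \<Rightarrow> real \<Rightarrow> (real \<Rightarrow> 'a \<Rightarrow> complex) \<Rightarrow> bool"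
  where "solution_on \<alpha> \<theta> u\<^sub>0 T u \<longleftrightarrow>
    0 < T \<and> u 0 = u\<^sub>0 \<and>
    C_in {0..T} (C0_space \<inter> H1_space) (\<lambda>f. sup_norm f + H1_norm f) u \<and>
    C_in {0<..<T} H2_space H2_norm u \<and>
    (\<exists>v. C_in {0<..<T} L2_space L2_norm v \<and>
         (\<forall>t\<in>{0<..<T}. has_L2_deriv u (v t) t \<and>
           (AE x in lborel. cis (- \<theta>) * v t x =
              weak_laplacian (u t) x + of_real (cmod (u t x) powr \<alpha>) * u t x)))"

text \<open>
  The values of \<open>u\<close> outside \<open>[0, Tmax)\<close> are irrelevant.  Maximality says that \<open>u\<close> is not the
  restriction of a solution on some \<open>[0,T]\<close> with \<open>T \<ge> Tmax\<close>.
\<close>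

definition maximal_solution ::
    "real \<Rightarrow> real \<Rightarrow> ('a::euclidean_space \<Rightarrow> complex) \<Rightarrow> ereal \<Rightarrow> (real \<Rightarrow> 'a \<Rightarrow> complex) \<Rightarrow> bool"
  where "maximal_solution \<alpha> \<theta> u\<^sub>0 Tmax u \<longleftrightarrow>
    0 < Tmax \<and>
    (\<forall>T. 0 < T \<and> ereal T < Tmax \<longrightarrow> solution_on \<alpha> \<theta> u\<^sub>0 T u) \<and>
    \<not> (\<exists>T w. Tmax \<le> ereal T \<and> solution_on \<alpha> \<theta> u\<^sub>0 T w \<and>
          (\<forall>t. 0 \<le> t \<and> ereal t < Tmax \<longrightarrow> w t = u t))"

end

(*
  The mass M = ||u||^2 and the energy E satisfy E' = - cos(theta) ||u_t||^2 and, with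
  J = int |u|^(alpha+2) - int |grad u|^2, the identity <u_t, u> = e^(i theta) J, hence
  M' = 2 cos(theta) J.  Since J >= -(alpha+2) E and J^2 = |<u_t, u>|^2 <= M ||u_t||^2, the
  quantity (-E) M^(-(alpha+2)/2) is nondecreasing, so M^(-alpha/2) decreases at least linearly and
  must vanish by the time stated in the theorem.

  Two devices replace the usual density arguments.  Integration by parts in H^1 comes from the
  difference quotients f(x + hb) - f(x) = h int_0^1 f'(x + shb) ds, which is checked against test
  functions.  The potential energy is differentiated through its convexity, using that
  |u|^alpha u is continuous in L^2 because the equation expresses it by u_t and the Laplacian of u.
*)

theory Submission
  imports Defs
begin

section \<open>The Hilbert space structure of \<open>L\<^sup>2\<close>\<close>

text \<open>The phase enters through u_t = e^(i theta) (Delta u + |u|^alpha u). Both M' and E'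
  contain only a real part and so one factor cos(theta), whereas Cauchy-Schwarz is applied to the
  modulus of <u_t, u> and loses no such factor. Hence cos(theta) cancels in the sign of the
  derivative of (-E) M^(-(alpha+2)/2), the exponent is the same for every angle, and cos(theta)
  survives only as the speed at which M^(-alpha/2) decreases.

  Regularity shapes the rest. The time derivative exists only in L^2 and only at interior times.
  Increments of mass and gradient energy are therefore written as exact pairings of the difference
  quotient with functions converging in L^2, so that no space derivative has to fall on the
  quotient; time 0 is reached by continuity alone. Moreover a weak derivative is a choice determined
  almost everywhere, so even its linearity is an almost-everywhere statement. It rests on the
  fundamental lemma of the calculus of variations, for which smooth bump functions are constructed
  by hand.\<close>

definition L2_inner :: "('a::euclidean_space \<Rightarrow> complex) \<Rightarrow> ('a \<Rightarrow> complex) \<Rightarrow> complex"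
  where "L2_inner f g = (LINT x|lborel. f x * cnj (g x))"

section \<open>Membership in L^2 and integrability of products\<close>

lemma L2_spaceD:
  assumes "f \<in> L2_space"
  shows "f \<in> borel_measurable borel" "integrable lborel (\<lambda>x. (cmod (f x))\<^sup>2)"
  using assms by (auto simp: L2_space_def)

lemma L2_spaceI:
  "f \<in> borel_measurable borel \<Longrightarrow> integrable lborel (\<lambda>x. (cmod (f x))\<^sup>2) \<Longrightarrow> f \<in> L2_space"
  by (auto simp: L2_space_def)

lemma L2_space_AE_bound:
  assumes g: "g \<in> L2_space" and f: "f \<in> borel_measurable borel"
    and le: "AE x in lborel. cmod (f x) \<le> C * cmod (g x)"
  shows "f \<in> L2_space"
proof (rule L2_spaceI[OF f])
  have [measurable]: "f \<in> borel_measurable borel" by fact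
  have "integrable lborel (\<lambda>x. C\<^sup>2 * (cmod (g x))\<^sup>2)"
    using L2_spaceD(2)[OF g] by simp
  then show "integrable lborel (\<lambda>x. (cmod (f x))\<^sup>2)"
  proof (rule Bochner_Integration.integrable_bound)
    show "AE x in lborel. norm ((cmod (f x))\<^sup>2) \<le> norm (C\<^sup>2 * (cmod (g x))\<^sup>2)"
      using le
    proof eventually_elim
      case (elim x)
      then have "(cmod (f x))\<^sup>2 \<le> (C * cmod (g x))\<^sup>2" by (intro power_mono) auto
      then show ?case by (simp add: power_mult_distrib)
    qed
  qed measurable
qed

lemma L2_space_cong_AE:
  assumes "g \<in> L2_space" "f \<in> borel_measurable borel" "AE x in lborel. f x = g x"
  shows "f \<in> L2_space"
  using assms(3) by (intro L2_space_AE_bound[OF assms(1,2), of 1]) auto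

lemma L2_space_add [intro]:
  assumes f: "f \<in> L2_space" and g: "g \<in> L2_space"
  shows "(\<lambda>x. f x + g x) \<in> L2_space"
proof (rule L2_spaceI)
  note [measurable] = L2_spaceD(1)[OF f] L2_spaceD(1)[OF g]
  show "(\<lambda>x. f x + g x) \<in> borel_measurable borel" by measurable
  have "integrable lborel (\<lambda>x. 2 * (cmod (f x))\<^sup>2 + 2 * (cmod (g x))\<^sup>2)"
    using L2_spaceD(2)[OF f] L2_spaceD(2)[OF g] by simp
  then show "integrable lborel (\<lambda>x. (cmod (f x + g x))\<^sup>2)"
  proof (rule Bochner_Integration.integrable_bound)
    show "AE x in lborel. norm ((cmod (f x + g x))\<^sup>2)
        \<le> norm (2 * (cmod (f x))\<^sup>2 + 2 * (cmod (g x))\<^sup>2)"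
    proof (rule AE_I2)
      fix x
      have "(cmod (f x + g x))\<^sup>2 \<le> (cmod (f x) + cmod (g x))\<^sup>2"
        by (intro power_mono norm_triangle_ineq) auto
      also have "\<dots> \<le> 2 * (cmod (f x))\<^sup>2 + 2 * (cmod (g x))\<^sup>2"
        using sum_squares_bound[of "cmod (f x)" "cmod (g x)"] by (simp add: power2_sum)
      finally show "norm ((cmod (f x + g x))\<^sup>2) \<le> norm (2 * (cmod (f x))\<^sup>2 + 2 * (cmod (g x))\<^sup>2)"
        by simp
    qed
  qed measurable
qed

lemma L2_space_cmult [intro]:
  assumes f: "f \<in> L2_space"
  shows "(\<lambda>x. c * f x) \<in> L2_space"
  by (rule L2_space_AE_bound[OF f, of _ "cmod c"])
    (use L2_spaceD(1)[OF f] in \<open>auto simp: norm_mult\<close>)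

lemma L2_space_divide [intro]: "f \<in> L2_space \<Longrightarrow> (\<lambda>x. f x / c) \<in> L2_space"
  using L2_space_cmult[of f "1 / c"] by simp

lemma L2_space_uminus [intro]: "f \<in> L2_space \<Longrightarrow> (\<lambda>x. - f x) \<in> L2_space"
  using L2_space_cmult[of f "-1"] by simp

lemma L2_space_diff [intro]:
  assumes "f \<in> L2_space" "g \<in> L2_space"
  shows "(\<lambda>x. f x - g x) \<in> L2_space"
  using L2_space_add[OF assms(1) L2_space_uminus[OF assms(2)]] by simp

lemma L2_space_zero [intro]: "(\<lambda>x. 0) \<in> L2_space"
  by (rule L2_spaceI) auto

lemma L2_space_sum [intro]:
  assumes "\<And>i. i \<in> A \<Longrightarrow> f i \<in> L2_space"
  shows "(\<lambda>x. \<Sum>i\<in>A. f i x) \<in> L2_space"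
  using assms
  by (induction A rule: infinite_finite_induct) (auto intro!: L2_space_add)

lemma L2_space_mult_integrable:
  assumes f: "f \<in> L2_space" and g: "g \<in> L2_space"
  shows "integrable lborel (\<lambda>x. f x * g x)"
proof -
  note [measurable] = L2_spaceD(1)[OF f] L2_spaceD(1)[OF g]
  have "integrable lborel (\<lambda>x. (cmod (f x))\<^sup>2 + (cmod (g x))\<^sup>2)"
    using L2_spaceD(2)[OF f] L2_spaceD(2)[OF g] by simp
  then show ?thesis
  proof (rule Bochner_Integration.integrable_bound)
    show "AE x in lborel. norm (f x * g x) \<le> norm ((cmod (f x))\<^sup>2 + (cmod (g x))\<^sup>2)"
    proof (rule AE_I2)
      fix x
      have "2 * (cmod (f x) * cmod (g x)) \<le> (cmod (f x))\<^sup>2 + (cmod (g x))\<^sup>2"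
        using sum_squares_bound[of "cmod (f x)" "cmod (g x)"] by (simp add: mult.assoc)
      moreover have "0 \<le> cmod (f x) * cmod (g x)" by simp
      ultimately have "cmod (f x) * cmod (g x) \<le> (cmod (f x))\<^sup>2 + (cmod (g x))\<^sup>2" by linarith
      then show "norm (f x * g x) \<le> norm ((cmod (f x))\<^sup>2 + (cmod (g x))\<^sup>2)"
        by (simp add: norm_mult)
    qed
  qed measurable
qed

lemma L2_space_cnj [intro]:
  assumes f: "f \<in> L2_space"
  shows "(\<lambda>x. cnj (f x)) \<in> L2_space"
proof (rule L2_space_AE_bound[OF f, of _ 1])
  note [measurable] = L2_spaceD(1)[OF f]
  have "cnj \<in> borel_measurable borel"
    by (intro borel_measurable_continuous_onI continuous_intros)
  then show "(\<lambda>x. cnj (f x)) \<in> borel_measurable borel"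
    by measurable
qed auto

lemma L2_inner_integrable:
  "f \<in> L2_space \<Longrightarrow> g \<in> L2_space \<Longrightarrow> integrable lborel (\<lambda>x. f x * cnj (g x))"
  by (intro L2_space_mult_integrable L2_space_cnj)

section \<open>Inner product, norm and Cauchy-Schwarz\<close>

lemma L2_norm_nonneg [simp]: "0 \<le> L2_norm f"
  by (simp add: L2_norm_def)

lemma L2_norm_sq: "(L2_norm f)\<^sup>2 = (LINT x|lborel. (cmod (f x))\<^sup>2)"
  by (simp add: L2_norm_def)

lemma L2_inner_self: "f \<in> L2_space \<Longrightarrow> L2_inner f f = of_real ((L2_norm f)\<^sup>2)"
  by (simp add: L2_inner_def L2_norm_sq complex_norm_square[symmetric] del: of_real_power)

lemma L2_inner_cong_AE:
  assumes "f \<in> L2_space" "g \<in> L2_space" "f' \<in> L2_space" "g' \<in> L2_space"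
    and "AE x in lborel. f x = f' x" "AE x in lborel. g x = g' x"
  shows "L2_inner f g = L2_inner f' g'"
  unfolding L2_inner_def
proof (rule integral_cong_AE)
  show "(\<lambda>x. f x * cnj (g x)) \<in> borel_measurable lborel"
    using L2_inner_integrable[OF assms(1,2)] by auto
  show "(\<lambda>x. f' x * cnj (g' x)) \<in> borel_measurable lborel"
    using L2_inner_integrable[OF assms(3,4)] by auto
  show "AE x in lborel. f x * cnj (g x) = f' x * cnj (g' x)"
    using assms(5,6) by eventually_elim simp
qed

lemma L2_norm_cong_AE:
  assumes "f \<in> L2_space" "g \<in> L2_space" "AE x in lborel. f x = g x"
  shows "L2_norm f = L2_norm g"
proof -
  have "(of_real ((L2_norm f)\<^sup>2) :: complex) = of_real ((L2_norm g)\<^sup>2)"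
    using L2_inner_cong_AE[OF assms(1,1,2,2) assms(3,3)] assms by (simp add: L2_inner_self)
  then show ?thesis
    by (metis L2_norm_nonneg of_real_eq_iff power2_eq_iff_nonneg)
qed

lemma L2_inner_commute: "L2_inner g f = cnj (L2_inner f g)"
proof -
  have "(LINT x|lborel. g x * cnj (f x)) = (LINT x|lborel. cnj (f x * cnj (g x)))"
    by (simp add: mult.commute)
  then show ?thesis
    unfolding L2_inner_def by (simp del: complex_cnj_mult)
qed

lemma L2_inner_add_left:
  "f \<in> L2_space \<Longrightarrow> g \<in> L2_space \<Longrightarrow> h \<in> L2_space \<Longrightarrow>
    L2_inner (\<lambda>x. f x + g x) h = L2_inner f h + L2_inner g h"
  by (simp add: L2_inner_def distrib_right L2_inner_integrable)

lemma L2_inner_cmult_left: "L2_inner (\<lambda>x. c * f x) h = c * L2_inner f h"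
  by (simp add: L2_inner_def mult.assoc)

lemma L2_inner_diff_left:
  "f \<in> L2_space \<Longrightarrow> g \<in> L2_space \<Longrightarrow> h \<in> L2_space \<Longrightarrow>
    L2_inner (\<lambda>x. f x - g x) h = L2_inner f h - L2_inner g h"
  by (simp add: L2_inner_def left_diff_distrib L2_inner_integrable)

lemma L2_inner_divide_left: "L2_inner (\<lambda>x. f x / c) h = L2_inner f h / c"
  using L2_inner_cmult_left[of "1 / c" f h] by simp

lemma L2_inner_add_right:
  "f \<in> L2_space \<Longrightarrow> g \<in> L2_space \<Longrightarrow> h \<in> L2_space \<Longrightarrow>
    L2_inner h (\<lambda>x. f x + g x) = L2_inner h f + L2_inner h g"
  by (simp add: L2_inner_def distrib_left L2_inner_integrable)

lemma L2_inner_diff_right: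
  "f \<in> L2_space \<Longrightarrow> g \<in> L2_space \<Longrightarrow> h \<in> L2_space \<Longrightarrow>
    L2_inner h (\<lambda>x. f x - g x) = L2_inner h f - L2_inner h g"
  by (simp add: L2_inner_def right_diff_distrib L2_inner_integrable)

lemma L2_inner_sum_left:
  assumes "\<And>i. i \<in> A \<Longrightarrow> f i \<in> L2_space" "h \<in> L2_space"
  shows "L2_inner (\<lambda>x. \<Sum>i\<in>A. f i x) h = (\<Sum>i\<in>A. L2_inner (f i) h)"
  unfolding L2_inner_def sum_distrib_right
  by (rule Bochner_Integration.integral_sum) (use assms L2_inner_integrable in blast)

lemma L2_norm_cmult: "L2_norm (\<lambda>x. c * f x) = cmod c * L2_norm f"
  by (simp add: L2_norm_def norm_mult power_mult_distrib real_sqrt_mult)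

lemma L2_norm_zero [simp]: "L2_norm (\<lambda>x. 0) = 0"
  by (simp add: L2_norm_def)

lemma L2_norm_mono_AE:
  assumes "g \<in> L2_space" "f \<in> L2_space" "AE x in lborel. cmod (f x) \<le> cmod (g x)"
  shows "L2_norm f \<le> L2_norm g"
  unfolding L2_norm_def
  by (intro real_sqrt_le_mono integral_mono_AE L2_spaceD assms)
    (use assms(3) in \<open>eventually_elim, auto intro: power_mono\<close>)

text \<open>Moduli stand on both factors because the Fubini argument for translates needs a bound on
  the absolute integral, which an estimate of \<open>L2_inner\<close> would not give.\<close>

lemma L2_Cauchy_Schwarz_abs:
  assumes f: "f \<in> L2_space" and g: "g \<in> L2_space"
  shows "(LINT x|lborel. cmod (f x) * cmod (g x)) \<le> L2_norm f * L2_norm g"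
proof -
  note [measurable] = L2_spaceD(1)[OF f] L2_spaceD(1)[OF g]
  have int: "integrable lborel (\<lambda>x. cmod (f x) * cmod (g x))"
    using integrable_norm[OF L2_space_mult_integrable[OF f g]] by (simp add: norm_mult)
  let ?I = "LINT x|lborel. cmod (f x) * cmod (g x)"
  have sq: "(\<integral>\<^sup>+x. ennreal ((cmod (h x))\<^sup>2) \<partial>lborel) = ennreal ((L2_norm h)\<^sup>2)"
    if "h \<in> L2_space" for h :: "'a \<Rightarrow> complex"
    using nn_integral_eq_integral[OF L2_spaceD(2)[OF that]]
    by (simp add: L2_norm_sq ennreal_power)
  have "(\<integral>\<^sup>+x. ennreal (cmod (f x)) * ennreal (cmod (g x)) \<partial>lborel)\<^sup>2
      \<le> (\<integral>\<^sup>+x. (ennreal (cmod (f x)))\<^sup>2 \<partial>lborel) * (\<integral>\<^sup>+x. (ennreal (cmod (g x)))\<^sup>2 \<partial>lborel)"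
    by (rule Cauchy_Schwarz_nn_integral) auto
  also have "(\<integral>\<^sup>+x. ennreal (cmod (f x)) * ennreal (cmod (g x)) \<partial>lborel) = ennreal ?I"
    using nn_integral_eq_integral[OF int] by (simp add: ennreal_mult)
  finally have "ennreal (?I\<^sup>2) \<le> ennreal ((L2_norm f * L2_norm g)\<^sup>2)"
    using f g by (simp add: sq ennreal_power ennreal_mult power_mult_distrib)
  then have "?I\<^sup>2 \<le> (L2_norm f * L2_norm g)\<^sup>2"
    by simp
  then show ?thesis
    by (rule power2_le_imp_le) simp
qed

lemma L2_Cauchy_Schwarz:
  assumes f: "f \<in> L2_space" and g: "g \<in> L2_space"
  shows "cmod (L2_inner f g) \<le> L2_norm f * L2_norm g"
proof -
  have "cmod (L2_inner f g) \<le> (LINT x|lborel. cmod (f x) * cmod (g x))"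
    unfolding L2_inner_def
    using integral_norm_bound[of lborel "\<lambda>x. f x * cnj (g x)"] by (simp add: norm_mult)
  with L2_Cauchy_Schwarz_abs[OF f g] show ?thesis by linarith
qed

lemma L2_norm_add_sq:
  assumes f: "f \<in> L2_space" and g: "g \<in> L2_space"
  shows "(L2_norm (\<lambda>x. f x + g x))\<^sup>2 = (L2_norm f)\<^sup>2 + 2 * Re (L2_inner f g) + (L2_norm g)\<^sup>2"
proof -
  have "of_real ((L2_norm (\<lambda>x. f x + g x))\<^sup>2) = L2_inner (\<lambda>x. f x + g x) (\<lambda>x. f x + g x)"
    by (simp add: L2_inner_self L2_space_add f g)
  also have "\<dots> = of_real ((L2_norm f)\<^sup>2) + (L2_inner f g + cnj (L2_inner f g)) + of_real ((L2_norm g)\<^sup>2)"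
    using f g by (simp add: L2_inner_add_left L2_inner_add_right L2_space_add L2_inner_self
        L2_inner_commute[of g f])
  finally have "complex_of_real ((L2_norm (\<lambda>x. f x + g x))\<^sup>2)
      = of_real ((L2_norm f)\<^sup>2 + 2 * Re (L2_inner f g) + (L2_norm g)\<^sup>2)"
    by (simp add: complex_add_cnj)
  then show ?thesis by (simp only: of_real_eq_iff)
qed

lemma L2_norm_triangle:
  assumes f: "f \<in> L2_space" and g: "g \<in> L2_space"
  shows "L2_norm (\<lambda>x. f x + g x) \<le> L2_norm f + L2_norm g"
proof (rule power2_le_imp_le)
  have "Re (L2_inner f g) \<le> L2_norm f * L2_norm g"
    using L2_Cauchy_Schwarz[OF f g] complex_Re_le_cmod order_trans by blast
  then show "(L2_norm (\<lambda>x. f x + g x))\<^sup>2 \<le> (L2_norm f + L2_norm g)\<^sup>2"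
    by (simp add: L2_norm_add_sq[OF f g] power2_sum)
qed simp

lemma L2_norm_diff_commute: "L2_norm (\<lambda>x. f x - g x) = L2_norm (\<lambda>x. g x - f x)"
  by (simp add: L2_norm_def norm_minus_commute)

lemma L2_norm_triangle_abs:
  assumes f: "f \<in> L2_space" and g: "g \<in> L2_space"
  shows "\<bar>L2_norm f - L2_norm g\<bar> \<le> L2_norm (\<lambda>x. f x - g x)"
  using L2_norm_triangle[OF L2_space_diff[OF f g] g] L2_norm_triangle[OF L2_space_diff[OF g f] f]
  by (simp add: L2_norm_diff_commute[of g f])

text \<open>Membership is part of the notion: the integral of a non-integrable function is 0 by
  default, so a small \<open>L2_norm\<close> by itself carries no information. It is asked only
  eventually, because the functions attached to times far from the limit time are
  uncontrolled.\<close>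

definition L2_lim ::
    "('b \<Rightarrow> 'a::euclidean_space \<Rightarrow> complex) \<Rightarrow> ('a \<Rightarrow> complex) \<Rightarrow> 'b filter \<Rightarrow> bool"
  where "L2_lim f l F \<longleftrightarrow> eventually (\<lambda>s. f s \<in> L2_space) F \<and> l \<in> L2_space \<and>
    ((\<lambda>s. L2_norm (\<lambda>x. f s x - l x)) \<longlongrightarrow> 0) F"

lemma L2_lim_const [intro]: "l \<in> L2_space \<Longrightarrow> L2_lim (\<lambda>_. l) l F"
  by (simp add: L2_lim_def)

lemma L2_lim_boundI:
  assumes "eventually (\<lambda>s. f s \<in> L2_space) F" "l \<in> L2_space"
    and "eventually (\<lambda>s. L2_norm (\<lambda>x. f s x - l x) \<le> B s) F" "(B \<longlongrightarrow> 0) F"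
  shows "L2_lim f l F"
  unfolding L2_lim_def
  using assms by (auto intro: tendsto_sandwich[OF _ _ tendsto_const])

lemma L2_lim_cong_AE:
  assumes f: "L2_lim f l F" and g: "eventually (\<lambda>s. g s \<in> L2_space) F" and m: "m \<in> L2_space"
    and fg: "eventually (\<lambda>s. AE x in lborel. f s x = g s x) F" and lm: "AE x in lborel. l x = m x"
  shows "L2_lim g m F"
proof (rule L2_lim_boundI[OF g m])
  show "((\<lambda>s. L2_norm (\<lambda>x. f s x - l x)) \<longlongrightarrow> 0) F"
    using f by (simp add: L2_lim_def)
  have fs: "eventually (\<lambda>s. f s \<in> L2_space) F" and l: "l \<in> L2_space" using f by (auto simp: L2_lim_def)
  have "eventually (\<lambda>s. f s \<in> L2_space \<and> g s \<in> L2_space \<and> (AE x in lborel. f s x = g s x)) F"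
    by (intro eventually_conj fs g fg)
  then show "eventually (\<lambda>s. L2_norm (\<lambda>x. g s x - m x) \<le> L2_norm (\<lambda>x. f s x - l x)) F"
  proof (rule eventually_mono)
    fix s
    assume elim: "f s \<in> L2_space \<and> g s \<in> L2_space \<and> (AE x in lborel. f s x = g s x)"
    then have "AE x in lborel. f s x = g s x" by blast
    then have "AE x in lborel. g s x - m x = f s x - l x"
      using lm by eventually_elim simp
    then show "L2_norm (\<lambda>x. g s x - m x) \<le> L2_norm (\<lambda>x. f s x - l x)"
      using elim l m by (intro eq_refl L2_norm_cong_AE) auto
  qed
qed

lemma L2_lim_add:
  assumes "L2_lim f l F" "L2_lim g m F"
  shows "L2_lim (\<lambda>s x. f s x + g s x) (\<lambda>x. l x + m x) F"
proof (rule L2_lim_boundI)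
  from assms have e: "eventually (\<lambda>s. f s \<in> L2_space) F" "eventually (\<lambda>s. g s \<in> L2_space) F"
    and lm: "l \<in> L2_space" "m \<in> L2_space" by (auto simp: L2_lim_def)
  show "eventually (\<lambda>s. (\<lambda>x. f s x + g s x) \<in> L2_space) F"
    using e by eventually_elim auto
  show "(\<lambda>x. l x + m x) \<in> L2_space" using lm by auto
  show "eventually (\<lambda>s. L2_norm (\<lambda>x. f s x + g s x - (l x + m x)) \<le>
      L2_norm (\<lambda>x. f s x - l x) + L2_norm (\<lambda>x. g s x - m x)) F"
    using e
  proof eventually_elim
    case (elim s)
    have "(\<lambda>x. f s x + g s x - (l x + m x)) = (\<lambda>x. (f s x - l x) + (g s x - m x))" by auto
    then show ?case using elim lm by (auto intro: L2_norm_triangle)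
  qed
  show "((\<lambda>s. L2_norm (\<lambda>x. f s x - l x) + L2_norm (\<lambda>x. g s x - m x)) \<longlongrightarrow> 0) F"
    using assms by (auto simp: L2_lim_def intro: tendsto_add_zero)
qed

lemma L2_lim_cmult:
  assumes "L2_lim f l F"
  shows "L2_lim (\<lambda>s x. c * f s x) (\<lambda>x. c * l x) F"
proof (rule L2_lim_boundI)
  from assms have e: "eventually (\<lambda>s. f s \<in> L2_space) F" and l: "l \<in> L2_space"
    by (auto simp: L2_lim_def)
  show "eventually (\<lambda>s. (\<lambda>x. c * f s x) \<in> L2_space) F"
    using e by eventually_elim auto
  show "(\<lambda>x. c * l x) \<in> L2_space" using l by auto
  show "eventually (\<lambda>s. L2_norm (\<lambda>x. c * f s x - c * l x) \<le> cmod c * L2_norm (\<lambda>x. f s x - l x)) F"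
    by (simp add: L2_norm_cmult right_diff_distrib[symmetric])
  show "((\<lambda>s. cmod c * L2_norm (\<lambda>x. f s x - l x)) \<longlongrightarrow> 0) F"
    using assms by (auto simp: L2_lim_def intro: tendsto_mult_right_zero)
qed

lemma L2_lim_diff:
  assumes "L2_lim f l F" "L2_lim g m F"
  shows "L2_lim (\<lambda>s x. f s x - g s x) (\<lambda>x. l x - m x) F"
  using L2_lim_add[OF assms(1) L2_lim_cmult[OF assms(2), of "-1"]] by simp

lemma L2_lim_sum:
  assumes "\<And>i. i \<in> A \<Longrightarrow> L2_lim (f i) (l i) F"
  shows "L2_lim (\<lambda>s x. \<Sum>i\<in>A. f i s x) (\<lambda>x. \<Sum>i\<in>A. l i x) F"
  using assms
  by (induction A rule: infinite_finite_induct) (auto intro!: L2_lim_add)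

lemma L2_lim_inner:
  assumes "L2_lim f l F" "L2_lim g m F"
  shows "((\<lambda>s. L2_inner (f s) (g s)) \<longlongrightarrow> L2_inner l m) F"
proof -
  from assms have e: "eventually (\<lambda>s. f s \<in> L2_space) F" "eventually (\<lambda>s. g s \<in> L2_space) F"
    and l: "l \<in> L2_space" and m: "m \<in> L2_space"
    and lim: "((\<lambda>s. L2_norm (\<lambda>x. f s x - l x)) \<longlongrightarrow> 0) F" "((\<lambda>s. L2_norm (\<lambda>x. g s x - m x)) \<longlongrightarrow> 0) F"
    by (auto simp: L2_lim_def)
  \<comment> \<open>The bound comes from <f,g> - <l,m> = <f-l,g> + <l,g-m>, with the norm of g
    replaced by that of g-m plus that of m, so that every ingredient has a known limit.\<close>
  let ?B = "\<lambda>s. L2_norm (\<lambda>x. f s x - l x) * (L2_norm (\<lambda>x. g s x - m x) + L2_norm m)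
      + L2_norm l * L2_norm (\<lambda>x. g s x - m x)"
  have "((\<lambda>s. L2_inner (f s) (g s) - L2_inner l m) \<longlongrightarrow> 0) F"
  proof (rule Lim_null_comparison)
    have "(?B \<longlongrightarrow> 0 * (0 + L2_norm m) + L2_norm l * 0) F"
      by (intro tendsto_intros lim)
    then show "(?B \<longlongrightarrow> 0) F" by simp
    show "eventually (\<lambda>s. norm (L2_inner (f s) (g s) - L2_inner l m) \<le> ?B s) F"
      using e
    proof eventually_elim
      case (elim s)
      note fs = elim(1) and gs = elim(2)
      have "L2_inner (f s) (g s) - L2_inner l m
          = L2_inner (\<lambda>x. f s x - l x) (g s) + L2_inner l (\<lambda>x. g s x - m x)"
        using fs gs l m by (simp add: L2_inner_diff_left L2_inner_diff_right)
      also have "norm \<dots> \<le> norm (L2_inner (\<lambda>x. f s x - l x) (g s)) + norm (L2_inner l (\<lambda>x. g s x - m x))"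
        by (rule norm_triangle_ineq)
      also have "\<dots> \<le> L2_norm (\<lambda>x. f s x - l x) * L2_norm (g s) + L2_norm l * L2_norm (\<lambda>x. g s x - m x)"
        by (intro add_mono L2_Cauchy_Schwarz L2_space_diff fs gs l m)
      also have "L2_norm (g s) \<le> L2_norm (\<lambda>x. g s x - m x) + L2_norm m"
        using L2_norm_triangle[OF L2_space_diff[OF gs m] m] by simp
      finally show ?case by (simp add: mult_left_mono)
    qed
  qed
  then show ?thesis using Lim_null by blast
qed

lemma L2_lim_norm:
  assumes "L2_lim f l F"
  shows "((\<lambda>s. L2_norm (f s)) \<longlongrightarrow> L2_norm l) F"
proof -
  from assms have e: "eventually (\<lambda>s. f s \<in> L2_space) F" and l: "l \<in> L2_space"
    and lim: "((\<lambda>s. L2_norm (\<lambda>x. f s x - l x)) \<longlongrightarrow> 0) F"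
    by (auto simp: L2_lim_def)
  have "((\<lambda>s. L2_norm (f s) - L2_norm l) \<longlongrightarrow> 0) F"
    by (rule Lim_null_comparison[OF _ lim])
      (use e in \<open>eventually_elim, use l L2_norm_triangle_abs in auto\<close>)
  then show ?thesis using Lim_null by blast
qed

section \<open>Test functions\<close>

lemma pderiv_dir_eq:
  assumes "(f has_derivative D) (at x)"
  shows "pderiv_dir b f x = D b"
  using frechet_derivative_at[OF assms] by (simp add: pderiv_dir_def)

lemma has_derivative_pderiv_dir:
  "f differentiable at x \<Longrightarrow> (f has_derivative (\<lambda>h. pderiv_dir h f x)) (at x)"
  unfolding pderiv_dir_def by (simp add: frechet_derivative_works)

section \<open>Closure properties of smooth functions\<close>

lemma Ck_const: "Ck k (\<lambda>x. c)"
proof (induction k arbitrary: c)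
  case (Suc k)
  have "pderiv_dir b (\<lambda>x::'a. c) = (\<lambda>x. 0)" for b
    by (intro ext pderiv_dir_eq) (rule has_derivative_const)
  then show ?case using Suc by simp
qed simp

lemma Ck_SucD: "Ck (Suc k) f \<Longrightarrow> Ck k f"
proof (induction k arbitrary: f)
  case 0
  then show ?case
    by (auto intro!: continuous_at_imp_continuous_on differentiable_imp_continuous_within)
qed (metis Ck.simps(2))

lemma Ck_add: "Ck k f \<Longrightarrow> Ck k g \<Longrightarrow> Ck k (\<lambda>x. f x + g x)"
proof (induction k arbitrary: f g)
  case (Suc k)
  have d: "((\<lambda>x. f x + g x) has_derivative (\<lambda>h. pderiv_dir h f x + pderiv_dir h g x)) (at x)" for x
    using Suc.prems by (intro has_derivative_add has_derivative_pderiv_dir) auto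
  have "pderiv_dir b (\<lambda>x. f x + g x) = (\<lambda>x. pderiv_dir b f x + pderiv_dir b g x)" for b
    by (intro ext pderiv_dir_eq[OF d])
  then show ?case using Suc by (auto intro!: differentiableI[OF d])
qed (auto intro: continuous_intros)

lemma Ck_mult: "Ck k f \<Longrightarrow> Ck k g \<Longrightarrow> Ck k (\<lambda>x. f x * g x)"
proof (induction k arbitrary: f g)
  case (Suc k)
  have d: "((\<lambda>x. f x * g x) has_derivative
      (\<lambda>h. f x * pderiv_dir h g x + pderiv_dir h f x * g x)) (at x)" for x
    using Suc.prems by (intro has_derivative_mult has_derivative_pderiv_dir) auto
  have "pderiv_dir b (\<lambda>x. f x * g x) = (\<lambda>x. f x * pderiv_dir b g x + pderiv_dir b f x * g x)" for b
    by (intro ext pderiv_dir_eq[OF d])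
  moreover have "Ck k f" "Ck k g" using Suc.prems by (auto intro: Ck_SucD)
  ultimately show ?case
    using Suc.prems Suc.IH by (auto intro!: Ck_add differentiableI[OF d])
qed (auto intro: continuous_intros)

lemma Ck_prod: "(\<And>i. i \<in> A \<Longrightarrow> Ck k (f i)) \<Longrightarrow> Ck k (\<lambda>x. \<Prod>i\<in>A. f i x)"
  by (induction A rule: infinite_finite_induct) (auto intro!: Ck_mult Ck_const)

lemma has_derivative_pderiv_dir_shift:
  assumes "f differentiable at (x + c)"
  shows "((\<lambda>x. f (x + c)) has_derivative (\<lambda>h. pderiv_dir h f (x + c))) (at x)"
proof -
  \<comment> \<open>The summand 0 is the derivative of the constant c, kept so that the chain rule
    matches literally.\<close>
  have "((\<lambda>x. f (x + c)) has_derivative (\<lambda>h. pderiv_dir (h + 0) f (x + c))) (at x)"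
    by (rule has_derivative_compose[where g = f and f = "\<lambda>x. x + c"])
      (auto intro!: derivative_eq_intros has_derivative_pderiv_dir assms)
  then show ?thesis by simp
qed

lemma Ck_shift: "Ck k f \<Longrightarrow> Ck k (\<lambda>x. f (x + c))"
proof (induction k arbitrary: f)
  case 0
  then show ?case by (auto intro!: continuous_on_compose2[of UNIV f] continuous_intros)
next
  case (Suc k)
  have d: "((\<lambda>x. f (x + c)) has_derivative (\<lambda>h. pderiv_dir h f (x + c))) (at x)" for x
    using Suc.prems by (intro has_derivative_pderiv_dir_shift) auto
  have "pderiv_dir b (\<lambda>x. f (x + c)) = (\<lambda>x. pderiv_dir b f (x + c))" for b
    by (intro ext pderiv_dir_eq[OF d])
  then show ?case using Suc by (auto intro!: differentiableI[OF d])
qed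

lemma test_functionsD:
  assumes "\<phi> \<in> test_functions"
  shows "Ck k \<phi>" "compact (closure {x. \<phi> x \<noteq> 0})" "\<phi> differentiable at x" "continuous_on UNIV \<phi>"
proof -
  have *: "\<forall>k. Ck k \<phi>" "compact (closure {x. \<phi> x \<noteq> 0})"
    using assms unfolding test_functions_def by blast+
  then show "Ck k \<phi>" "compact (closure {x. \<phi> x \<noteq> 0})" by blast+
  show "\<phi> differentiable at x" "continuous_on UNIV \<phi>"
    using *(1)[THEN spec, of 0] *(1)[THEN spec, of "Suc 0"] by simp_all
qed

lemma test_functions_shift:
  assumes \<phi>: "\<phi> \<in> test_functions"
  shows "(\<lambda>x. \<phi> (x + c)) \<in> test_functions"
proof -
  have "{x. \<phi> (x + c) \<noteq> 0} = (\<lambda>x. -c + x) ` {x. \<phi> x \<noteq> 0}"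
    by (auto intro!: image_eqI[where x = "_ + c"])
  then have "closure {x. \<phi> (x + c) \<noteq> 0} = (\<lambda>x. -c + x) ` closure {x. \<phi> x \<noteq> 0}"
    by (simp only: closure_translation)
  moreover have "compact ((\<lambda>x. -c + x) ` closure {x. \<phi> x \<noteq> 0})"
    by (intro compact_translation test_functionsD \<phi>)
  ultimately show ?thesis
    using test_functionsD(1)[OF \<phi>] by (simp only: test_functions_def Ck_shift mem_Collect_eq simp_thms)
qed

lemma pderiv_dir_test_functions_shift:
  "\<phi> \<in> test_functions \<Longrightarrow> pderiv_dir b (\<lambda>x. \<phi> (x + c)) x = pderiv_dir b \<phi> (x + c)"
  by (intro pderiv_dir_eq has_derivative_pderiv_dir_shift test_functionsD)

lemma pderiv_dir_continuous:
  "\<phi> \<in> test_functions \<Longrightarrow> b \<in> Basis \<Longrightarrow> continuous_on UNIV (pderiv_dir b \<phi>)"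
  using test_functionsD(1)[of \<phi> "Suc 0"] by auto

lemma pderiv_dir_eq_0:
  assumes "x \<notin> closure {x. \<phi> x \<noteq> 0}"
  shows "pderiv_dir b \<phi> x = 0"
proof -
  have "(\<phi> has_derivative (\<lambda>h. 0)) (at x)"
  proof (rule has_derivative_transform_within_open[where f = "\<lambda>x. 0"])
    show "open (- closure {x. \<phi> x \<noteq> 0})" by auto
    show "x \<in> - closure {x. \<phi> x \<noteq> 0}" using assms by auto
    show "0 = \<phi> y" if "y \<in> - closure {x. \<phi> x \<noteq> 0}" for y
      using that closure_subset[of "{x. \<phi> x \<noteq> 0}"] by auto
  qed simp
  then show ?thesis by (rule pderiv_dir_eq)
qed

text \<open>The functions \<open>P(1/x) exp(-1/x)\<close>, extended by \<open>0\<close> to \<open>x \<le> 0\<close>, are closed under differentiation.\<close>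

definition flat_exp :: "real poly \<Rightarrow> real \<Rightarrow> real"
  where "flat_exp P x = (if x > 0 then poly P (1 / x) * exp (- (1 / x)) else 0)"

text \<open>Under the substitution y = 1/x, flatness at 0 from the right becomes the decay of
  exp(-y) against polynomials at infinity.\<close>

lemma poly_times_exp_minus_tendsto_0: "((\<lambda>y. poly P y * exp (- y)) \<longlongrightarrow> (0::real)) at_top"
proof -
  have "((\<lambda>y::real. \<Sum>i\<le>degree P. coeff P i * (y ^ i / exp y)) \<longlongrightarrow> 0) at_top"
    by (intro tendsto_null_sum tendsto_mult_right_zero tendsto_power_div_exp_0)
  then show ?thesis
    by (simp add: poly_altdef sum_divide_distrib exp_minus divide_inverse[symmetric])
qed

text \<open>With y = 1/x one has dy/dx = -y^2, so P(y) exp(-y) has the x-derivative y^2 (P(y) -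
  P'(y)) exp(-y); \<open>[:0, 0, 1:]\<close> is the polynomial y^2. The junction at 0 needs the
  one-sided difference quotients.\<close>

lemma flat_exp_has_derivative:
  "(flat_exp P has_real_derivative flat_exp ([:0, 0, 1:] * (P - pderiv P)) x) (at x)"
proof -
  consider "x > 0" | "x < 0" | "x = 0" by linarith
  then show ?thesis
  proof cases
    case 1
    have "((\<lambda>x. poly P (1 / x) * exp (- (1 / x))) has_real_derivative
        flat_exp ([:0, 0, 1:] * (P - pderiv P)) x) (at x)"
      using 1 by (auto intro!: derivative_eq_intros simp: flat_exp_def field_simps power2_eq_square)
    then show ?thesis
      by (rule has_field_derivative_transform_within_open[of _ _ _ "{0<..}"])
        (use 1 in \<open>auto simp: flat_exp_def\<close>)
  next
    case 2
    have "((\<lambda>x. 0) has_real_derivative flat_exp ([:0, 0, 1:] * (P - pderiv P)) x) (at x)"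
      using 2 by (simp add: flat_exp_def)
    then show ?thesis
      by (rule has_field_derivative_transform_within_open[of _ _ _ "{..<0}"])
        (use 2 in \<open>auto simp: flat_exp_def\<close>)
  next
    case 3
    have "((\<lambda>h. flat_exp P h / h) \<longlongrightarrow> 0) (at_right 0)"
    proof -
      \<comment> \<open>Division by h is one more factor y = 1/h, that is, P is replaced by the
        polynomial y P(y).\<close>
      have "((\<lambda>h. poly ([:0, 1:] * P) (1 / h) * exp (- (1 / h))) \<longlongrightarrow> (0::real)) (at_right 0)"
        by (rule filterlim_compose[OF poly_times_exp_minus_tendsto_0])
          (simp add: filterlim_inverse_at_top_right divide_inverse)
      moreover have "eventually (\<lambda>h::real. h > 0) (at_right 0)"
        by (simp add: eventually_at_right_less)
      then have "eventually (\<lambda>h. poly ([:0, 1:] * P) (1 / h) * exp (- (1 / h)) = flat_exp P h / h) (at_right 0)"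
        by eventually_elim (simp add: flat_exp_def)
      ultimately show ?thesis by (rule Lim_transform_eventually)
    qed
    moreover have "((\<lambda>h. flat_exp P h / h) \<longlongrightarrow> 0) (at_left 0)"
    proof (rule Lim_transform_eventually[OF tendsto_const])
      have "eventually (\<lambda>h::real. h < 0) (at_left 0)"
        by (simp add: eventually_at_left_real eventually_at_topological) auto
      then show "eventually (\<lambda>h. 0 = flat_exp P h / h) (at_left 0)"
        by eventually_elim (simp add: flat_exp_def)
    qed
    ultimately have "((\<lambda>h. flat_exp P h / h) \<longlongrightarrow> 0) (at 0)"
      by (simp add: filterlim_split_at)
    then show ?thesis
      by (simp add: 3 has_field_derivative_iff flat_exp_def[of _ 0])
  qed
qed

text \<open>The induction must run over all P, since differentiation changes the polynomial. The
  argument is affine along one coordinate, so the chain rule contributes only the constant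
  \<open>d * (b \<bullet> i)\<close> and the class is preserved.\<close>

lemma Ck_flat_exp: "Ck k (\<lambda>x. complex_of_real (flat_exp P (c + d * (x \<bullet> i))))"
proof (induction k arbitrary: P)
  case 0
  have "continuous_on UNIV (flat_exp P)"
    by (intro continuous_at_imp_continuous_on ballI DERIV_isCont[OF flat_exp_has_derivative])
  then show ?case
    by (auto intro!: continuous_intros continuous_on_compose2[of UNIV "flat_exp P"])
next
  case (Suc k)
  let ?P = "[:0, 0, 1:] * (P - pderiv P)"
  have d: "((\<lambda>x. complex_of_real (flat_exp P (c + d * (x \<bullet> i)))) has_derivative
      (\<lambda>h. of_real (flat_exp ?P (c + d * (x \<bullet> i)) * (d * (h \<bullet> i))))) (at x)" for x
  proof -
    have "((\<lambda>x. c + d * (x \<bullet> i)) has_derivative (\<lambda>h. d * (h \<bullet> i))) (at x)"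
      by (auto intro!: derivative_eq_intros)
    from has_derivative_compose[OF this flat_exp_has_derivative[unfolded has_field_derivative_def]]
    show ?thesis by (rule has_derivative_of_real)
  qed
  have "pderiv_dir b (\<lambda>x. complex_of_real (flat_exp P (c + d * (x \<bullet> i))))
      = (\<lambda>x. of_real (flat_exp ?P (c + d * (x \<bullet> i))) * of_real (d * (b \<bullet> i)))" for b
    using pderiv_dir_eq[OF d] by auto
  then show ?case using Suc by (auto intro!: Ck_mult Ck_const differentiableI[OF d])
qed

section \<open>Smooth approximation of the indicator of an open box\<close>

lemma flat_exp_1_bounds: "0 \<le> flat_exp 1 x" "flat_exp 1 x \<le> 1" "flat_exp 1 x \<noteq> 0 \<longleftrightarrow> 0 < x"
  by (auto simp: flat_exp_def)

text \<open>Each face of the box contributes a factor exp(-1/(n a)), with a the signed distance to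
  the face, and 0 when a \<le> 0. For a > 0 it tends to 1 as n grows, while all factors stay between
  0 and 1, as dominated convergence wants. The arguments are spelled in the form
  \<open>c + d * (x \<bullet> i)\<close> that \<open>Ck_flat_exp\<close> covers.\<close>

definition box_bump :: "'a::euclidean_space \<Rightarrow> 'a \<Rightarrow> nat \<Rightarrow> 'a \<Rightarrow> real"
  where "box_bump l u n x =
    (\<Prod>i\<in>Basis. flat_exp 1 (- real n * (l \<bullet> i) + real n * (x \<bullet> i)) *
      flat_exp 1 (real n * (u \<bullet> i) + (- real n) * (x \<bullet> i)))"

lemma box_bump_bounds: "0 \<le> box_bump l u n x" "box_bump l u n x \<le> 1"
  unfolding box_bump_def
  by (intro prod_nonneg prod_le_1 mult_nonneg_nonneg mult_le_one flat_exp_1_bounds conjI ballI)+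

lemma box_bump_outside: "x \<notin> box l u \<Longrightarrow> box_bump l u n x = 0"
proof -
  assume "x \<notin> box l u"
  then obtain i where i: "i \<in> Basis" "\<not> (l \<bullet> i < x \<bullet> i \<and> x \<bullet> i < u \<bullet> i)"
    by (auto simp: mem_box)
  then have "- real n * (l \<bullet> i) + real n * (x \<bullet> i) \<le> 0 \<or> real n * (u \<bullet> i) + (- real n) * (x \<bullet> i) \<le> 0"
    by (auto simp: not_less intro: mult_left_mono)
  then have "flat_exp 1 (- real n * (l \<bullet> i) + real n * (x \<bullet> i)) *
      flat_exp 1 (real n * (u \<bullet> i) + (- real n) * (x \<bullet> i)) = 0"
    by (auto simp: flat_exp_def)
  then show ?thesis unfolding box_bump_def using i(1) by (intro prod_zero) auto
qed

lemma box_bump_test_function: "(\<lambda>x. complex_of_real (box_bump l u n x)) \<in> test_functions"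
proof -
  have "Ck k (\<lambda>x. complex_of_real (box_bump l u n x))" for k
    unfolding box_bump_def of_real_prod of_real_mult
    by (intro Ck_prod Ck_mult Ck_flat_exp)
  moreover have "{x. complex_of_real (box_bump l u n x) \<noteq> 0} \<subseteq> box l u"
    using box_bump_outside by force
  then have "closure {x. complex_of_real (box_bump l u n x) \<noteq> 0} \<subseteq> cbox l u"
    by (intro closure_minimal order_trans[OF _ box_subset_cbox] closed_cbox)
  then have "compact (closure {x. complex_of_real (box_bump l u n x) \<noteq> 0})"
    by (metis closed_closure compact_Int_closed compact_cbox inf.absorb_iff2)
  ultimately show ?thesis by (simp add: test_functions_def)
qed

lemma box_bump_tendsto: "(\<lambda>n. box_bump l u n x) \<longlonglongrightarrow> indicator (box l u) x"
proof (cases "x \<in> box l u")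
  case True
  have *: "(\<lambda>n. flat_exp 1 (real n * a)) \<longlonglongrightarrow> 1" if "a > 0" for a
  proof -
    have "(\<lambda>n. exp (- (1 / a / real n))) \<longlonglongrightarrow> exp (- 0)"
      by (intro tendsto_intros lim_const_over_n)
    moreover have "eventually (\<lambda>n. exp (- (1 / a / real n)) = flat_exp 1 (real n * a)) sequentially"
      using eventually_gt_at_top[of 0] by eventually_elim (use that in \<open>simp add: flat_exp_def mult.commute\<close>)
    ultimately show ?thesis by (simp add: tendsto_cong)
  qed
  have "(\<lambda>n. box_bump l u n x) \<longlonglongrightarrow> (\<Prod>i\<in>(Basis::'a set). 1 * 1)"
    unfolding box_bump_def
  proof (intro tendsto_prod tendsto_mult)
    fix i :: 'a assume i: "i \<in> Basis"
    show "(\<lambda>n. flat_exp 1 (- real n * (l \<bullet> i) + real n * (x \<bullet> i))) \<longlonglongrightarrow> 1"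
      using *[of "x \<bullet> i - l \<bullet> i"] True i by (auto simp: mem_box algebra_simps)
    show "(\<lambda>n. flat_exp 1 (real n * (u \<bullet> i) + (- real n) * (x \<bullet> i))) \<longlonglongrightarrow> 1"
      using *[of "u \<bullet> i - x \<bullet> i"] True i by (auto simp: mem_box algebra_simps)
  qed
  then show ?thesis using True by simp
qed (simp add: box_bump_outside)

section \<open>The fundamental lemma of the calculus of variations\<close>

lemma integrable_eq_0_if_box_integrals_0:
  fixes h :: "'a::euclidean_space \<Rightarrow> complex"
  assumes h: "integrable lborel h"
    and h0: "(LINT x|lborel. h x) = 0"
    and box: "\<And>l u. (LINT x:box l u|lborel. h x) = 0"
  shows "AE x in lborel. h x = 0"
proof (rule sigma_finite_measure.density_zero[OF sigma_finite_lborel h])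
  fix A :: "'a set" assume "A \<in> sets lborel"
  then have A: "A \<in> sigma_sets UNIV (range (\<lambda>(a, b). box a b :: 'a set))"
    by (simp add: borel_eq_box)
  \<comment> \<open>Open boxes are closed under intersection and generate the Borel sets, so
    vanishing integrals extend from boxes to all Borel sets by Dynkin's induction.\<close>
  have stable: "Int_stable (range (\<lambda>(a, b). box a b :: 'a set))"
    by (auto simp: Int_stable_def box_Int_box)
  have sub: "range (\<lambda>(a, b). box a b :: 'a set) \<subseteq> Pow UNIV" by simp
  from stable sub A show "(LINT x:A|lborel. h x) = 0"
  proof (induction rule: sigma_sets_induct_disjoint)
    case (basic A)
    then show ?case using box by auto
  next
    case empty
    show ?case by (simp add: set_lebesgue_integral_def)
  next
    \<comment> \<open>The integral over the complement is the total integral minus the one over A.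
      The whole space is not a box, so the total is controlled by a hypothesis of its own.\<close>
    case (compl A)
    then have A: "A \<in> sets lborel" by (simp add: borel_eq_box)
    have "set_integrable lborel A h" "set_integrable lborel (- A) h"
      unfolding set_integrable_def using A h by (auto intro!: integrable_mult_indicator)
    then have "(LINT x:A \<union> - A|lborel. h x) = (LINT x:A|lborel. h x) + (LINT x:- A|lborel. h x)"
      by (intro set_integral_Un) auto
    then show ?case using compl.IH h0 by (simp add: set_lebesgue_integral_def Compl_eq_Diff_UNIV)
  next
    case (union A)
    then have A: "A i \<in> sets lborel" for i by (auto simp: borel_eq_box)
    have "(LINT x:(\<Union>i. A i)|lborel. h x) = (\<Sum>i. LINT x:A i|lborel. h x)"
    proof (rule lebesgue_integral_countable_add)
      show "A i \<inter> A j = {}" if "i \<noteq> j" for i j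
        using union(1) that by (auto simp: disjoint_family_on_def)
      show "set_integrable lborel (\<Union>i. A i) h"
        unfolding set_integrable_def using A h by (auto intro!: integrable_mult_indicator)
    qed (use A in auto)
    then show ?case using union by simp
  qed
qed

text \<open>Local integrability yields measurability only of the truncations to compact sets; the
  function is their pointwise limit along growing balls.\<close>

lemma locally_integrable_measurable:
  assumes "locally_integrable h"
  shows "h \<in> borel_measurable borel"
proof (rule borel_measurable_LIMSEQ_metric)
  fix n :: nat
  show "(\<lambda>x. indicator (cball 0 (real n)) x *\<^sub>R h x) \<in> borel_measurable borel"
    using assms unfolding locally_integrable_def set_integrable_def
    by (metis borel_measurable_integrable compact_cball measurable_lborel2)
next
  fix x :: 'a
  obtain N :: nat where N: "norm x \<le> real N" using real_arch_simple by blast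
  have "eventually (\<lambda>n. indicator (cball 0 (real n)) x *\<^sub>R h x = h x) sequentially"
    using eventually_ge_at_top[of N] by eventually_elim (use N in \<open>auto simp: indicator_def\<close>)
  then show "(\<lambda>n. indicator (cball 0 (real n)) x *\<^sub>R h x) \<longlonglongrightarrow> h x"
    by (rule tendsto_eventually)
qed

text \<open>Bumps converge to the indicator of an open box and are dominated by the indicator of the
  closed box, which is compact, so h is integrable there. Dominated convergence thus turns the
  hypothesis on test functions into vanishing integrals over boxes.\<close>

lemma locally_integrable_AE_eq_0:
  assumes h: "locally_integrable h"
    and test: "\<And>\<phi>. \<phi> \<in> test_functions \<Longrightarrow> (LINT x|lborel. h x * \<phi> x) = 0"
  shows "AE x in lborel. h x = 0"
proof -
  note [measurable] = locally_integrable_measurable[OF h]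
  have int: "integrable lborel (\<lambda>x. indicator (cbox l u) x *\<^sub>R h x)" for l u
    using h by (auto simp: locally_integrable_def set_integrable_def)
  have box: "(LINT x:box l u|lborel. h x) = 0" for l u
  proof -
    have "(\<lambda>n. LINT x|lborel. h x * complex_of_real (box_bump l u n x))
        \<longlonglongrightarrow> (LINT x|lborel. indicator (box l u) x *\<^sub>R h x)"
    proof (rule integral_dominated_convergence)
      show "integrable lborel (\<lambda>x. norm (indicator (cbox l u) x *\<^sub>R h x))"
        by (intro integrable_norm int)
      show "(\<lambda>x. h x * complex_of_real (box_bump l u n x)) \<in> borel_measurable lborel" for n
      proof -
        note [measurable] = borel_measurable_continuous_onI[OF test_functionsD(4)[OF box_bump_test_function[of l u n]]]
        show ?thesis by measurable
      qed
      show "AE x in lborel. (\<lambda>n. h x * complex_of_real (box_bump l u n x))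
          \<longlonglongrightarrow> indicator (box l u) x *\<^sub>R h x"
      proof (rule AE_I2)
        fix x
        have "(\<lambda>n. h x * complex_of_real (box_bump l u n x)) \<longlonglongrightarrow> h x * complex_of_real (indicator (box l u) x)"
          by (intro tendsto_intros box_bump_tendsto)
        then show "(\<lambda>n. h x * complex_of_real (box_bump l u n x)) \<longlonglongrightarrow> indicator (box l u) x *\<^sub>R h x"
          by (simp add: scaleR_conv_of_real mult.commute)
      qed
      show "AE x in lborel. norm (h x * complex_of_real (box_bump l u n x))
          \<le> norm (indicator (cbox l u) x *\<^sub>R h x)" for n
      proof (rule AE_I2)
        fix x
        show "norm (h x * complex_of_real (box_bump l u n x)) \<le> norm (indicator (cbox l u) x *\<^sub>R h x)"
        proof (cases "x \<in> box l u")
          case True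
          then have "x \<in> cbox l u" using box_subset_cbox by blast
          then show ?thesis
            using box_bump_bounds[of l u n x] by (simp add: norm_mult mult_left_le)
        qed (simp add: box_bump_outside)
      qed
    qed auto
    moreover have "(LINT x|lborel. h x * complex_of_real (box_bump l u n x)) = 0" for n
      by (rule test[OF box_bump_test_function])
    ultimately show ?thesis
      by (simp add: LIMSEQ_const_iff set_lebesgue_integral_def)
  qed
  \<comment> \<open>The criterion on boxes speaks of globally integrable functions, so h is cut off
    to boxes exhausting the space. Two boxes meet in a box, hence the cut-off function inherits the
    vanishing box integrals.\<close>
  let ?B = "\<lambda>n::nat. box (- (real n *\<^sub>R One)) (real n *\<^sub>R One) :: 'a set"
  have "AE x in lborel. indicator (?B n) x *\<^sub>R h x = 0" for n
  proof (rule integrable_eq_0_if_box_integrals_0)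
    have "integrable lborel (\<lambda>x. indicator (?B n) x *\<^sub>R
        (indicator (cbox (- (real n *\<^sub>R One)) (real n *\<^sub>R One)) x *\<^sub>R h x))"
      by (intro integrable_mult_indicator int) auto
    also have "(\<lambda>x. indicator (?B n) x *\<^sub>R
        (indicator (cbox (- (real n *\<^sub>R One)) (real n *\<^sub>R One)) x *\<^sub>R h x))
        = (\<lambda>x. indicator (?B n) x *\<^sub>R h x)"
      using box_subset_cbox[of "- (real n *\<^sub>R One) :: 'a" "real n *\<^sub>R One"]
      by (auto simp: indicator_def fun_eq_iff)
    finally show "integrable lborel (\<lambda>x. indicator (?B n) x *\<^sub>R h x)" .
    show "(LINT x|lborel. indicator (?B n) x *\<^sub>R h x) = 0"
      using box by (simp add: set_lebesgue_integral_def)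
    show "(LINT x:box l u|lborel. indicator (?B n) x *\<^sub>R h x) = 0" for l u
    proof -
      have "\<exists>l' u'. box l u \<inter> ?B n = box l' u'" unfolding box_Int_box by blast
      then obtain l' u' where eq: "box l u \<inter> ?B n = box l' u'" by blast
      have "indicator (box l u) x *\<^sub>R indicator (?B n) x *\<^sub>R h x = indicator (box l' u') x *\<^sub>R h x" for x
        unfolding eq[symmetric] indicator_def by auto
      then show ?thesis
        using box[of l' u'] by (simp only: set_lebesgue_integral_def)
    qed
  qed
  then have "AE x in lborel. \<forall>n. indicator (?B n) x *\<^sub>R h x = 0"
    by (simp only: AE_all_countable simp_thms)
  then show ?thesis
  proof eventually_elim
    case (elim x)
    have "x \<in> (\<Union>n. ?B n)" using UN_box_eq_UNIV by blast
    then show ?case using elim by (auto simp: indicator_def)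
  qed
qed

section \<open>Weak derivatives\<close>

lemma locally_integrable_mult:
  assumes h: "locally_integrable h" and \<phi>: "continuous_on UNIV \<phi>" and K: "compact K"
    and out: "\<And>x. x \<notin> K \<Longrightarrow> \<phi> x = 0"
  shows "integrable lborel (\<lambda>x. h x * \<phi> x)"
proof -
  note [measurable] = locally_integrable_measurable[OF h] borel_measurable_continuous_onI[OF \<phi>]
  have "bounded (\<phi> ` K)"
    by (intro compact_imp_bounded compact_continuous_image K continuous_on_subset[OF \<phi>]) auto
  then obtain B where B: "\<And>x. x \<in> K \<Longrightarrow> norm (\<phi> x) \<le> B" by (auto simp: bounded_iff)
  have "integrable lborel (\<lambda>x. B *\<^sub>R (indicator K x *\<^sub>R h x))"
    using h K by (intro integrable_scaleR_right) (simp add: locally_integrable_def set_integrable_def)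
  then show ?thesis
  proof (rule Bochner_Integration.integrable_bound)
    show "AE x in lborel. norm (h x * \<phi> x) \<le> norm (B *\<^sub>R (indicator K x *\<^sub>R h x))"
    proof (rule AE_I2)
      fix x
      show "norm (h x * \<phi> x) \<le> norm (B *\<^sub>R (indicator K x *\<^sub>R h x))"
      proof (cases "x \<in> K")
        case True
        then have "norm (\<phi> x) \<le> \<bar>B\<bar>" using B by force
        then show ?thesis using True by (simp add: norm_mult mult.commute mult_right_mono)
      qed (simp add: out)
    qed
  qed measurable
qed

lemma eq_0_outside_closure_support: "x \<notin> closure {x. \<phi> x \<noteq> 0} \<Longrightarrow> \<phi> x = 0"
  using closure_subset[of "{x. \<phi> x \<noteq> 0}"] by auto

lemma locally_integrable_mult_test:
  assumes "locally_integrable h" "\<phi> \<in> test_functions"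
  shows "integrable lborel (\<lambda>x. h x * \<phi> x)"
  using assms
  by (intro locally_integrable_mult[where K = "closure {x. \<phi> x \<noteq> 0}"] test_functionsD
      eq_0_outside_closure_support)

lemma locally_integrable_mult_pderiv_test:
  assumes "locally_integrable h" "\<phi> \<in> test_functions" "b \<in> Basis"
  shows "integrable lborel (\<lambda>x. h x * pderiv_dir b \<phi> x)"
  using assms
  by (intro locally_integrable_mult[where K = "closure {x. \<phi> x \<noteq> 0}"] test_functionsD
      pderiv_dir_continuous pderiv_dir_eq_0)

lemma L2_space_continuous_compact:
  fixes \<phi> :: "'a::euclidean_space \<Rightarrow> complex"
  assumes \<phi>: "continuous_on UNIV \<phi>" and K: "compact K" and out: "\<And>x. x \<notin> K \<Longrightarrow> \<phi> x = 0"
  shows "\<phi> \<in> L2_space"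
proof (rule L2_spaceI)
  show "\<phi> \<in> borel_measurable borel" by (rule borel_measurable_continuous_onI[OF \<phi>])
  have "integrable lborel (\<lambda>x. indicator K x *\<^sub>R (cmod (\<phi> x))\<^sup>2)"
    by (intro borel_integrable_compact K continuous_intros continuous_on_subset[OF \<phi>]) auto
  also have "(\<lambda>x. indicator K x *\<^sub>R (cmod (\<phi> x))\<^sup>2) = (\<lambda>x. (cmod (\<phi> x))\<^sup>2)"
    using out by (fastforce simp: indicator_def)
  finally show "integrable lborel (\<lambda>x. (cmod (\<phi> x))\<^sup>2)" .
qed

lemma L2_space_test:
  assumes "\<phi> \<in> test_functions"
  shows "\<phi> \<in> L2_space" "b \<in> Basis \<Longrightarrow> pderiv_dir b \<phi> \<in> L2_space"
proof -
  show "\<phi> \<in> L2_space"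
    using assms
    by (intro L2_space_continuous_compact[where K = "closure {x. \<phi> x \<noteq> 0}"] test_functionsD
        eq_0_outside_closure_support)
  show "pderiv_dir b \<phi> \<in> L2_space" if "b \<in> Basis"
    using assms that
    by (intro L2_space_continuous_compact[where K = "closure {x. \<phi> x \<noteq> 0}"] test_functionsD
        pderiv_dir_continuous pderiv_dir_eq_0)
qed

text \<open>Pairing with this function writes an integral over a compact set as an L^2 pairing;
  local integrability of L^2 functions and of segment averages follows.\<close>

lemma L2_space_indicator_compact:
  "compact K \<Longrightarrow> (\<lambda>x. complex_of_real (indicator K x)) \<in> L2_space"
proof (rule L2_spaceI)
  assume K: "compact K"
  then have [measurable]: "K \<in> sets borel" by (simp add: borel_compact)
  show "(\<lambda>x. complex_of_real (indicator K x)) \<in> borel_measurable borel" by measurable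
  have "integrable lborel (indicator K :: 'a \<Rightarrow> real)"
    using K by (intro integrable_real_indicator emeasure_compact_finite) auto
  moreover have "(\<lambda>x. (cmod (complex_of_real (indicator K x)))\<^sup>2) = indicator K"
    by (auto simp: indicator_def)
  ultimately show "integrable lborel (\<lambda>x. (cmod (complex_of_real (indicator K x)))\<^sup>2)" by simp
qed

lemma L2_space_locally_integrable:
  assumes "f \<in> L2_space"
  shows "locally_integrable f"
  unfolding locally_integrable_def set_integrable_def
  using L2_space_mult_integrable[OF L2_space_indicator_compact assms]
  by (simp add: scaleR_conv_of_real)

lemma locally_integrable_cong_AE:
  assumes g: "locally_integrable g" and f [measurable]: "f \<in> borel_measurable borel"
    and eq: "AE x in lborel. f x = g x"
  shows "locally_integrable f"
  unfolding locally_integrable_def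
proof (intro allI impI)
  fix K :: "'a set" assume K: "compact K"
  then have [measurable]: "K \<in> sets borel" by (simp add: borel_compact)
  have int: "integrable lborel (\<lambda>x. indicator K x *\<^sub>R g x)"
    using g K by (auto simp: locally_integrable_def set_integrable_def)
  then show "set_integrable lborel K f"
    unfolding set_integrable_def
    by (rule Bochner_Integration.integrable_bound)
      (measurable, use eq in \<open>eventually_elim, simp\<close>)
qed

lemma locally_integrable_add:
  "locally_integrable f \<Longrightarrow> locally_integrable g \<Longrightarrow> locally_integrable (\<lambda>x. f x + g x)"
  unfolding locally_integrable_def by (auto intro: set_integral_add)

lemma locally_integrable_cmult:
  "locally_integrable f \<Longrightarrow> locally_integrable (\<lambda>x. c * f x)"
  unfolding locally_integrable_def set_integrable_def
  by (auto simp: mult_scaleR_right[symmetric] simp del: mult_scaleR_right)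

section \<open>Linearity and uniqueness of weak derivatives\<close>

lemma has_weak_pderiv_add:
  assumes "b \<in> Basis" "has_weak_pderiv b f f'" "has_weak_pderiv b g g'"
  shows "has_weak_pderiv b (\<lambda>x. f x + g x) (\<lambda>x. f' x + g' x)"
  using assms
  by (auto simp: has_weak_pderiv_def locally_integrable_add distrib_right
      locally_integrable_mult_test locally_integrable_mult_pderiv_test)

lemma has_weak_pderiv_cmult:
  assumes "has_weak_pderiv b f f'"
  shows "has_weak_pderiv b (\<lambda>x. c * f x) (\<lambda>x. c * f' x)"
  using assms
  by (auto simp: has_weak_pderiv_def locally_integrable_cmult mult.assoc)

lemma has_weak_pderiv_diff:
  assumes "b \<in> Basis" "has_weak_pderiv b f f'" "has_weak_pderiv b g g'"
  shows "has_weak_pderiv b (\<lambda>x. f x - g x) (\<lambda>x. f' x - g' x)"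
  using has_weak_pderiv_add[OF assms(1,2) has_weak_pderiv_cmult[OF assms(3), of "-1"]] by simp

text \<open>The difference rule for f and f itself shows that g - g' is a weak derivative of 0, so
  it integrates to 0 against every test function.\<close>

lemma has_weak_pderiv_unique:
  assumes b: "b \<in> Basis" and g: "has_weak_pderiv b f g" and g': "has_weak_pderiv b f g'"
  shows "AE x in lborel. g x = g' x"
proof -
  have d: "has_weak_pderiv b (\<lambda>x. f x - f x) (\<lambda>x. g x - g' x)"
    by (rule has_weak_pderiv_diff[OF b g g'])
  have "AE x in lborel. g x - g' x = 0"
    using d by (intro locally_integrable_AE_eq_0) (auto simp: has_weak_pderiv_def)
  then show ?thesis by simp
qed

text \<open>Second weak derivatives are taken of a chosen first derivative, which is known only up
  to a null set; this lets them be computed from any other representative.\<close>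

lemma has_weak_pderiv_cong_AE:
  assumes f: "has_weak_pderiv b f g" and [measurable]: "f' \<in> borel_measurable borel"
    and eq: "AE x in lborel. f' x = f x" and b: "b \<in> Basis"
  shows "has_weak_pderiv b f' g"
proof -
  have lf: "locally_integrable f" and lg: "locally_integrable g" using f by (auto simp: has_weak_pderiv_def)
  note [measurable] = locally_integrable_measurable[OF lf]
  have "(LINT x|lborel. f' x * pderiv_dir b \<phi> x) = (LINT x|lborel. f x * pderiv_dir b \<phi> x)"
    if \<phi>: "\<phi> \<in> test_functions" for \<phi>
  proof (rule integral_cong_AE)
    note [measurable] = borel_measurable_continuous_onI[OF pderiv_dir_continuous[OF \<phi> b]]
    show "(\<lambda>x. f' x * pderiv_dir b \<phi> x) \<in> borel_measurable lborel"
      "(\<lambda>x. f x * pderiv_dir b \<phi> x) \<in> borel_measurable lborel" by measurable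
    show "AE x in lborel. f' x * pderiv_dir b \<phi> x = f x * pderiv_dir b \<phi> x"
      using eq by eventually_elim simp
  qed
  then show ?thesis
    using f lg locally_integrable_cong_AE[OF lf _ eq] by (simp add: has_weak_pderiv_def)
qed

section \<open>Sobolev spaces and the chosen weak derivative\<close>

lemma has_weak_pderiv_weak_pderiv:
  assumes "has_weak_pderiv b f g"
  shows "has_weak_pderiv b f (weak_pderiv b f)"
  unfolding weak_pderiv_def using assms by (rule someI[where P = "has_weak_pderiv b f"])

lemma weak_pderiv_AE_eq:
  assumes "b \<in> Basis" "has_weak_pderiv b f g"
  shows "AE x in lborel. weak_pderiv b f x = g x"
  using has_weak_pderiv_unique[OF assms(1) has_weak_pderiv_weak_pderiv] assms(2) by blast

text \<open>The space provides some weak derivative in L^2, while \<open>weak_pderiv\<close> picks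
  possibly another one; uniqueness almost everywhere carries square integrability over to the chosen
  one.\<close>

lemma H1_spaceD:
  assumes "f \<in> H1_space"
  shows "f \<in> L2_space"
    and "b \<in> Basis \<Longrightarrow> has_weak_pderiv b f (weak_pderiv b f)"
    and "b \<in> Basis \<Longrightarrow> weak_pderiv b f \<in> L2_space"
proof -
  show "f \<in> L2_space" using assms by (simp add: H1_space_def)
  assume b: "b \<in> Basis"
  then obtain g where g: "g \<in> L2_space" "has_weak_pderiv b f g"
    using assms by (auto simp: H1_space_def)
  show w: "has_weak_pderiv b f (weak_pderiv b f)"
    by (rule has_weak_pderiv_weak_pderiv[OF g(2)])
  show "weak_pderiv b f \<in> L2_space"
    using w locally_integrable_measurable
    by (intro L2_space_cong_AE[OF g(1) _ weak_pderiv_AE_eq[OF b g(2)]]) (auto simp: has_weak_pderiv_def)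
qed

lemma H1_spaceI:
  "f \<in> L2_space \<Longrightarrow> (\<And>b. b \<in> Basis \<Longrightarrow> \<exists>g\<in>L2_space. has_weak_pderiv b f g) \<Longrightarrow> f \<in> H1_space"
  by (auto simp: H1_space_def)

lemma H1_space_diff:
  assumes "f \<in> H1_space" "g \<in> H1_space"
  shows "(\<lambda>x. f x - g x) \<in> H1_space"
  by (rule H1_spaceI) (use assms in \<open>blast intro: has_weak_pderiv_diff H1_spaceD\<close>)+

lemma weak_pderiv_diff_AE:
  assumes "f \<in> H1_space" "g \<in> H1_space" "b \<in> Basis"
  shows "AE x in lborel. weak_pderiv b (\<lambda>x. f x - g x) x = weak_pderiv b f x - weak_pderiv b g x"
  by (intro weak_pderiv_AE_eq has_weak_pderiv_diff H1_spaceD assms)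

lemma H1_space_cong_AE:
  assumes f: "f \<in> H1_space" and g: "g \<in> borel_measurable borel" and eq: "AE x in lborel. g x = f x"
  shows "g \<in> H1_space"
proof (rule H1_spaceI)
  show "g \<in> L2_space" by (rule L2_space_cong_AE[OF H1_spaceD(1)[OF f] g eq])
  show "\<exists>h\<in>L2_space. has_weak_pderiv b g h" if b: "b \<in> Basis" for b
    using has_weak_pderiv_cong_AE[OF H1_spaceD(2)[OF f b] g eq b] H1_spaceD(3)[OF f b] by blast
qed

lemma H2_spaceD:
  assumes "f \<in> H2_space"
  shows "f \<in> H1_space" and "b \<in> Basis \<Longrightarrow> weak_pderiv b f \<in> H1_space"
proof -
  show f: "f \<in> H1_space" using assms by (simp add: H2_space_def)
  assume b: "b \<in> Basis"
  then obtain g where g: "g \<in> H1_space" "has_weak_pderiv b f g"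
    using assms by (auto simp: H2_space_def)
  show "weak_pderiv b f \<in> H1_space"
    by (rule H1_space_cong_AE[OF g(1) L2_spaceD(1)[OF H1_spaceD(3)[OF f b]] weak_pderiv_AE_eq[OF b g(2)]])
qed

text \<open>\<open>H2_norm\<close> of a difference involves derivatives chosen for the difference.
  Relating them to the derivatives chosen for f and g separately takes one change of representative
  at the first order before the second derivative is formed.\<close>

lemma H2_has_weak_pderiv_diff:
  assumes f: "f \<in> H2_space" and g: "g \<in> H2_space" and b: "b \<in> Basis" and c: "c \<in> Basis"
  shows "has_weak_pderiv c (weak_pderiv b (\<lambda>x. f x - g x))
    (\<lambda>x. weak_pderiv c (weak_pderiv b f) x - weak_pderiv c (weak_pderiv b g) x)"
proof -
  note H1 = H2_spaceD(1)[OF f] H2_spaceD(1)[OF g]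
  have "weak_pderiv b (\<lambda>x. f x - g x) \<in> borel_measurable borel"
    by (intro L2_spaceD H1_spaceD H1_space_diff H1 b)
  then show ?thesis
    by (intro has_weak_pderiv_cong_AE[OF _ _ weak_pderiv_diff_AE[OF H1 b] c]
        has_weak_pderiv_diff H1_spaceD H2_spaceD f g b c)
qed

lemma H2_weak_pderiv_diff_AE:
  assumes "f \<in> H2_space" "g \<in> H2_space" "b \<in> Basis" "c \<in> Basis"
  shows "AE x in lborel. weak_pderiv c (weak_pderiv b (\<lambda>x. f x - g x)) x
    = weak_pderiv c (weak_pderiv b f) x - weak_pderiv c (weak_pderiv b g) x"
  by (rule weak_pderiv_AE_eq[OF assms(4) H2_has_weak_pderiv_diff[OF assms]])

section \<open>Translations and integration by parts\<close>

lemma lborel_integral_translation: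
  fixes f :: "'a::euclidean_space \<Rightarrow> complex"
  assumes [measurable]: "f \<in> borel_measurable borel"
  shows "(LINT x|lborel. f (x + c)) = (LINT x|lborel. f x)"
proof -
  have "(LINT x|lborel. f x) = (LINT x|distr lborel borel ((+) c). f x)"
    by (simp add: lborel_distr_plus)
  also have "\<dots> = (LINT x|lborel. f (c + x))"
    by (subst integral_distr) auto
  finally show ?thesis by (simp add: add.commute)
qed

lemma lborel_integrable_translation:
  fixes f :: "'a::euclidean_space \<Rightarrow> 'b::{banach, second_countable_topology}"
  assumes f: "integrable lborel f"
  shows "integrable lborel (\<lambda>x. f (x + c))"
proof -
  have "integrable (distr lborel borel ((+) c)) f"
    using f by (simp add: lborel_distr_plus)
  then have "integrable lborel (\<lambda>x. f (c + x))"
    by (rule integrable_distr[rotated]) auto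
  then show ?thesis by (simp add: add.commute)
qed

lemma L2_space_shift:
  assumes "f \<in> L2_space"
  shows "(\<lambda>x. f (x + c)) \<in> L2_space"
  using L2_spaceD[OF assms] lborel_integrable_translation[OF L2_spaceD(2)[OF assms], of c]
  by (intro L2_spaceI) auto

text \<open>Invariance of Lebesgue measure makes the translation by -c the adjoint of the
  translation by c.\<close>

lemma L2_inner_shift:
  assumes f: "f \<in> L2_space" and g: "g \<in> L2_space"
  shows "L2_inner (\<lambda>x. f (x + c)) g = L2_inner f (\<lambda>x. g (x - c))"
proof -
  have "(\<lambda>x. f x * cnj (g (x - c))) \<in> borel_measurable borel"
    using L2_inner_integrable[OF f L2_space_shift[OF g, of "-c"]] by auto
  from lborel_integral_translation[OF this, of c] show ?thesis
    by (simp add: L2_inner_def)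
qed

lemma L2_norm_shift:
  assumes f: "f \<in> L2_space"
  shows "L2_norm (\<lambda>x. f (x + c)) = L2_norm f"
proof -
  have "L2_inner (\<lambda>x. f (x + c)) (\<lambda>x. f (x + c)) = L2_inner f f"
    using L2_inner_shift[OF f L2_space_shift[OF f], of c c] by simp
  then have "complex_of_real ((L2_norm (\<lambda>x. f (x + c)))\<^sup>2) = of_real ((L2_norm f)\<^sup>2)"
    by (simp only: L2_inner_self[OF f] L2_inner_self[OF L2_space_shift[OF f]])
  then show ?thesis
    by (metis L2_norm_nonneg of_real_eq_iff power2_eq_iff_nonneg)
qed

text \<open>For each s the absolute x-integral is at most \<open>L2_norm F * L2_norm G\<close>,
  because a translate has the same norm. This bound is constant in s, hence integrable over the unit
  interval, and Fubini applies.\<close>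

lemma integrable_shift_product:
  fixes F G :: "'a::euclidean_space \<Rightarrow> complex"
  assumes F: "F \<in> L2_space" and G: "G \<in> L2_space"
  shows "integrable (lborel \<Otimes>\<^sub>M lborel)
    (\<lambda>(s, x). indicator {0..1::real} s *\<^sub>R (F (x + s *\<^sub>R c) * G x))"
proof (rule lborel_pair.Fubini_integrable)
  note [measurable] = L2_spaceD(1)[OF F] L2_spaceD(1)[OF G]
  show "(\<lambda>(s, x). indicator {0..1::real} s *\<^sub>R (F (x + s *\<^sub>R c) * G x))
      \<in> borel_measurable (lborel \<Otimes>\<^sub>M lborel)"
    by measurable
  show "AE s in lborel. integrable lborel
      (\<lambda>x. case (s, x) of (s, x) \<Rightarrow> indicator {0..1::real} s *\<^sub>R (F (x + s *\<^sub>R c) * G x))"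
    by (auto intro!: AE_I2 L2_space_mult_integrable L2_space_shift F G)
  have "integrable lborel (\<lambda>s. indicator {0..1::real} s *\<^sub>R (L2_norm F * L2_norm G))"
    by (rule borel_integrable_compact) auto
  then show "integrable lborel (\<lambda>s. LINT x|lborel.
      norm (case (s, x) of (s, x) \<Rightarrow> indicator {0..1::real} s *\<^sub>R (F (x + s *\<^sub>R c) * G x)))"
  proof (rule Bochner_Integration.integrable_bound)
    show "AE s in lborel. norm (LINT x|lborel.
        norm (case (s, x) of (s, x) \<Rightarrow> indicator {0..1::real} s *\<^sub>R (F (x + s *\<^sub>R c) * G x)))
        \<le> norm (indicator {0..1::real} s *\<^sub>R (L2_norm F * L2_norm G))"
    proof (rule AE_I2)
      fix s :: real
      have "(LINT x|lborel. cmod (F (x + s *\<^sub>R c)) * cmod (G x)) \<le> L2_norm F * L2_norm G"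
        using L2_Cauchy_Schwarz_abs[OF L2_space_shift[OF F] G, of "s *\<^sub>R c"] by (simp add: L2_norm_shift F)
      then show "norm (LINT x|lborel.
        norm (case (s, x) of (s, x) \<Rightarrow> indicator {0..1::real} s *\<^sub>R (F (x + s *\<^sub>R c) * G x)))
        \<le> norm (indicator {0..1::real} s *\<^sub>R (L2_norm F * L2_norm G))"
        by (auto simp: indicator_def norm_mult abs_of_nonneg)
    qed
  qed measurable
qed

lemma integrable_shift_inner:
  fixes F G :: "'a::euclidean_space \<Rightarrow> complex"
  assumes F: "F \<in> L2_space" and G: "G \<in> L2_space"
  shows "integrable lborel (\<lambda>s. indicator {0..1::real} s *\<^sub>R L2_inner (\<lambda>x. F (x + s *\<^sub>R c)) G)"
  using lborel_pair.integrable_fst[OF integrable_shift_product[OF F L2_space_cnj[OF G]], of c]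
  by (simp add: L2_inner_def)

text \<open>For smooth F this is the mean in the fundamental theorem of calculus from x to x + c.
  Where the s-integral diverges the value is 0 by default, so for L^2 functions the average is
  handled through its pairings.\<close>

definition segment_average :: "('a::euclidean_space \<Rightarrow> complex) \<Rightarrow> 'a \<Rightarrow> 'a \<Rightarrow> complex"
  where "segment_average F c x = (LINT s|lborel. indicator {0..1::real} s *\<^sub>R F (x + s *\<^sub>R c))"

text \<open>Exchanging the integrals reduces each pairing with the average to pairings with single
  translates, where the definition of the weak derivative can act.\<close>

lemma segment_average_mult:
  assumes F: "F \<in> L2_space" and G: "G \<in> L2_space"
  shows "integrable lborel (\<lambda>x. segment_average F c x * G x)"
    and "(LINT x|lborel. segment_average F c x * G x)
      = (LINT s|lborel. indicator {0..1::real} s *\<^sub>R (LINT x|lborel. F (x + s *\<^sub>R c) * G x))"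
proof -
  have eq: "(LINT s|lborel. indicator {0..1::real} s *\<^sub>R (F (x + s *\<^sub>R c) * G x)) = segment_average F c x * G x" for x
    by (simp add: segment_average_def mult_scaleR_left[symmetric] del: mult_scaleR_left)
  note int = integrable_shift_product[OF F G, of c]
  show "integrable lborel (\<lambda>x. segment_average F c x * G x)"
    using lborel_pair.integrable_snd[OF int] by (simp add: eq)
  show "(LINT x|lborel. segment_average F c x * G x)
      = (LINT s|lborel. indicator {0..1::real} s *\<^sub>R (LINT x|lborel. F (x + s *\<^sub>R c) * G x))"
    using lborel_pair.Fubini_integral[OF int] by (simp add: eq)
qed

lemma segment_average_locally_integrable:
  assumes F: "F \<in> L2_space"
  shows "locally_integrable (segment_average F c)"
  unfolding locally_integrable_def set_integrable_def
  using segment_average_mult(1)[OF F L2_space_indicator_compact, of _ c]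
  by (simp add: scaleR_conv_of_real mult.commute)

text \<open>The classical fundamental theorem along a segment. The direction is -hb because moving a
  translation from the weak derivative to the test function reverses it.\<close>

lemma segment_average_test:
  assumes \<phi>: "\<phi> \<in> test_functions" and b: "b \<in> Basis"
  shows "of_real h * segment_average (pderiv_dir b \<phi>) (- (h *\<^sub>R b)) y = \<phi> y - \<phi> (y - h *\<^sub>R b)"
proof -
  \<comment> \<open>The sign makes \<open>?g\<close> a primitive of \<open>?g'\<close>: the inner
    derivative -h and the leading minus combine to h, and \<open>?g 1 - ?g 0\<close> is the wanted
    difference.\<close>
  let ?g = "\<lambda>s. - \<phi> (y + s *\<^sub>R (- (h *\<^sub>R b)))"
  let ?g' = "\<lambda>s. of_real h * pderiv_dir b \<phi> (y + s *\<^sub>R (- (h *\<^sub>R b)))"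
  have d: "(?g has_vector_derivative ?g' s) (at s within {0..1})" for s
  proof -
    have "((\<lambda>s. y + s *\<^sub>R (- (h *\<^sub>R b))) has_derivative (\<lambda>t. t *\<^sub>R (- (h *\<^sub>R b)))) (at s)"
      by (auto intro!: derivative_eq_intros)
    from has_derivative_compose[OF this has_derivative_pderiv_dir[OF test_functionsD(3)[OF \<phi>]]]
    have D: "((\<lambda>s. \<phi> (y + s *\<^sub>R (- (h *\<^sub>R b)))) has_derivative
        (\<lambda>t. pderiv_dir (t *\<^sub>R (- (h *\<^sub>R b))) \<phi> (y + s *\<^sub>R (- (h *\<^sub>R b))))) (at s)" .
    have lin: "pderiv_dir (t *\<^sub>R (- (h *\<^sub>R b))) \<phi> x = (- t * h) *\<^sub>R pderiv_dir b \<phi> x" for t x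
    proof -
      have "linear (\<lambda>v. pderiv_dir v \<phi> x)"
        using has_derivative_linear[OF has_derivative_pderiv_dir[OF test_functionsD(3)[OF \<phi>]]] .
      from linear_cmul[OF this, of "- t * h" b] show ?thesis by simp
    qed
    have "(?g has_derivative (\<lambda>t. t *\<^sub>R ?g' s)) (at s)"
      by (rule has_derivative_eq_rhs[OF has_derivative_minus[OF D]])
        (simp only: lin scaleR_conv_of_real of_real_mult of_real_minus minus_mult_left minus_minus
          mult.assoc)
    then show ?thesis
      unfolding has_vector_derivative_def by (rule has_derivative_at_withinI)
  qed
  have c: "continuous_on {0..1} ?g'"
    by (intro continuous_intros continuous_on_compose2[OF pderiv_dir_continuous[OF \<phi> b]]) auto
  have "(LINT s|lborel. indicator {0..1} s *\<^sub>R ?g' s) = ?g 1 - ?g 0"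
    by (rule integral_FTC_Icc[OF _ d c]) auto
  then show ?thesis
    by (simp add: segment_average_def mult_scaleR_right[symmetric] del: mult_scaleR_right)
qed

text \<open>By duality: tested against \<phi>, the identity becomes the classical one for \<phi>,
  after Fubini, a translation and the definition of the weak derivative. Equality of all these
  pairings gives equality almost everywhere.\<close>

lemma weak_FTC:
  assumes f: "f \<in> L2_space" and f': "f' \<in> L2_space" and b: "b \<in> Basis"
    and w: "has_weak_pderiv b f f'"
  shows "AE x in lborel. f (x + h *\<^sub>R b) - f x = of_real h * segment_average f' (h *\<^sub>R b) x"
proof -
  let ?D = "segment_average f' (h *\<^sub>R b)"
  have shift: "(\<lambda>x. f (x + h *\<^sub>R b)) \<in> L2_space" by (rule L2_space_shift[OF f])
  have loc: "locally_integrable (\<lambda>x. f (x + h *\<^sub>R b) - f x)" "locally_integrable (\<lambda>x. (- of_real h) * ?D x)"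
    by (intro L2_space_locally_integrable L2_space_diff shift f)
      (intro locally_integrable_cmult segment_average_locally_integrable f')
  have "AE x in lborel. (f (x + h *\<^sub>R b) - f x) + (- of_real h) * ?D x = 0"
  proof (rule locally_integrable_AE_eq_0)
    show "locally_integrable (\<lambda>x. (f (x + h *\<^sub>R b) - f x) + (- of_real h) * ?D x)"
      by (rule locally_integrable_add[OF loc])
    fix \<phi> :: "'a \<Rightarrow> complex" assume \<phi>: "\<phi> \<in> test_functions"
    note \<phi>2 = L2_space_test(1)[OF \<phi>] and d\<phi>2 = L2_space_test(2)[OF \<phi> b]
    have \<phi>s: "(\<lambda>x. \<phi> (x - h *\<^sub>R b)) \<in> L2_space" using L2_space_shift[OF \<phi>2, of "- (h *\<^sub>R b)"] by simp
    \<comment> \<open>At a fixed s, the translation is shifted onto \<phi>, the weak derivative is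
      integrated by parts against the translated test function, and the derivative of that translate
      is the translate of the derivative.\<close>
    have inner: "(LINT x|lborel. f' (x + s *\<^sub>R (h *\<^sub>R b)) * \<phi> x)
        = - (LINT x|lborel. pderiv_dir b \<phi> (x + s *\<^sub>R (- (h *\<^sub>R b))) * f x)" for s :: real
    proof -
      let ?c = "s *\<^sub>R (h *\<^sub>R b)"
      have \<psi>: "(\<lambda>x. \<phi> (x + - ?c)) \<in> test_functions" by (rule test_functions_shift[OF \<phi>])
      have "(\<lambda>x. f' x * \<phi> (x + - ?c)) \<in> borel_measurable borel"
        using L2_space_mult_integrable[OF f' L2_space_test(1)[OF \<psi>]] by auto
      from lborel_integral_translation[OF this, of ?c]
      have "(LINT x|lborel. f' (x + ?c) * \<phi> x) = (LINT x|lborel. f' x * \<phi> (x + - ?c))" by simp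
      also have "\<dots> = - (LINT x|lborel. f x * pderiv_dir b (\<lambda>x. \<phi> (x + - ?c)) x)"
        using w \<psi> by (auto simp: has_weak_pderiv_def)
      also have "\<dots> = - (LINT x|lborel. pderiv_dir b \<phi> (x + s *\<^sub>R (- (h *\<^sub>R b))) * f x)"
        by (subst pderiv_dir_test_functions_shift[OF \<phi>]) (simp add: mult.commute)
      finally show ?thesis .
    qed
    have D: "(LINT x|lborel. ?D x * \<phi> x)
        = - (LINT x|lborel. segment_average (pderiv_dir b \<phi>) (- (h *\<^sub>R b)) x * f x)"
      unfolding segment_average_mult(2)[OF f' \<phi>2] segment_average_mult(2)[OF d\<phi>2 f] inner
      by simp
    have "of_real h * (LINT x|lborel. ?D x * \<phi> x)
        = - (LINT x|lborel. (of_real h * segment_average (pderiv_dir b \<phi>) (- (h *\<^sub>R b)) x) * f x)"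
      by (simp add: D mult.assoc)
    also have "\<dots> = - (LINT x|lborel. \<phi> x * f x - \<phi> (x - h *\<^sub>R b) * f x)"
      by (simp add: segment_average_test[OF \<phi> b] left_diff_distrib)
    also have "\<dots> = (LINT x|lborel. \<phi> (x - h *\<^sub>R b) * f x) - (LINT x|lborel. \<phi> x * f x)"
      using L2_space_mult_integrable[OF \<phi>2 f] L2_space_mult_integrable[OF \<phi>s f] by simp
    also have "(LINT x|lborel. \<phi> (x - h *\<^sub>R b) * f x) = (LINT x|lborel. \<phi> x * f (x + h *\<^sub>R b))"
    proof -
      have "(\<lambda>x. \<phi> (x - h *\<^sub>R b) * f x) \<in> borel_measurable borel"
        using L2_space_mult_integrable[OF \<phi>s f] by auto
      from lborel_integral_translation[OF this, of "h *\<^sub>R b"] show ?thesis by simp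
    qed
    finally have eq: "of_real h * (LINT x|lborel. ?D x * \<phi> x)
        = (LINT x|lborel. \<phi> x * f (x + h *\<^sub>R b)) - (LINT x|lborel. \<phi> x * f x)" .
    have "(LINT x|lborel. ((f (x + h *\<^sub>R b) - f x) + (- of_real h) * ?D x) * \<phi> x)
        = (LINT x|lborel. (\<phi> x * f (x + h *\<^sub>R b) - \<phi> x * f x) - of_real h * (?D x * \<phi> x))"
      by (simp add: algebra_simps)
    also have "\<dots> = (LINT x|lborel. \<phi> x * f (x + h *\<^sub>R b)) - (LINT x|lborel. \<phi> x * f x)
        - of_real h * (LINT x|lborel. ?D x * \<phi> x)"
      using L2_space_mult_integrable[OF \<phi>2 f] L2_space_mult_integrable[OF \<phi>2 shift]
        segment_average_mult(1)[OF f' \<phi>2, of "h *\<^sub>R b"]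
      by simp
    finally show "(LINT x|lborel. ((f (x + h *\<^sub>R b) - f x) + (- of_real h) * ?D x) * \<phi> x) = 0"
      by (simp add: eq)
  qed
  then show ?thesis by eventually_elim (simp add: algebra_simps)
qed

section \<open>Difference quotients in L^2 and integration by parts\<close>

lemma weak_FTC_inner:
  assumes f: "f \<in> L2_space" and f': "f' \<in> L2_space" and b: "b \<in> Basis"
    and w: "has_weak_pderiv b f f'" and g: "g \<in> L2_space"
  shows "L2_inner (\<lambda>x. f (x + h *\<^sub>R b) - f x) g
    = of_real h * (LINT s|lborel. indicator {0..1::real} s *\<^sub>R L2_inner (\<lambda>x. f' (x + s *\<^sub>R (h *\<^sub>R b))) g)"
proof -
  have "L2_inner (\<lambda>x. f (x + h *\<^sub>R b) - f x) g
      = (LINT x|lborel. of_real h * (segment_average f' (h *\<^sub>R b) x * cnj (g x)))"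
    unfolding L2_inner_def
  proof (rule integral_cong_AE)
    show "(\<lambda>x. (f (x + h *\<^sub>R b) - f x) * cnj (g x)) \<in> borel_measurable lborel"
      by (intro borel_measurable_integrable L2_inner_integrable L2_space_diff L2_space_shift f g)
    show "(\<lambda>x. of_real h * (segment_average f' (h *\<^sub>R b) x * cnj (g x))) \<in> borel_measurable lborel"
      by (intro borel_measurable_integrable integrable_mult_right segment_average_mult f' L2_space_cnj g)
    show "AE x in lborel. (f (x + h *\<^sub>R b) - f x) * cnj (g x)
        = of_real h * (segment_average f' (h *\<^sub>R b) x * cnj (g x))"
      using weak_FTC[OF f f' b w, of h] by eventually_elim simp
  qed
  then show ?thesis
    by (simp add: segment_average_mult(2)[OF f' L2_space_cnj[OF g]] L2_inner_def)
qed

lemma norm_indicator_integral_le: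
  fixes F :: "real \<Rightarrow> complex"
  assumes int: "integrable lborel (\<lambda>s. indicator {0..1} s *\<^sub>R F s)"
    and B: "\<And>s. 0 \<le> s \<Longrightarrow> s \<le> 1 \<Longrightarrow> norm (F s) \<le> B"
  shows "norm (LINT s|lborel. indicator {0..1} s *\<^sub>R F s) \<le> B"
proof -
  have "norm (LINT s|lborel. indicator {0..1} s *\<^sub>R F s) \<le> (LINT s|lborel. norm (indicator {0..1} s *\<^sub>R F s))"
    by (rule integral_norm_bound)
  also have "\<dots> \<le> (LINT s|lborel. indicator {0..1::real} s *\<^sub>R B)"
    by (intro integral_mono integrable_norm int borel_integrable_compact)
      (auto simp: indicator_def B)
  also have "\<dots> = B" by simp
  finally show ?thesis .
qed

text \<open>Pairing the weak fundamental theorem with the difference itself yields the square of its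
  norm on one side and one power of it on the other. The case of norm 0 is separate because that
  power is cancelled.\<close>

lemma L2_norm_shift_diff_le:
  assumes g: "g \<in> L2_space" and g': "g' \<in> L2_space" and b: "b \<in> Basis"
    and w: "has_weak_pderiv b g g'"
  shows "L2_norm (\<lambda>x. g (x + h *\<^sub>R b) - g x) \<le> \<bar>h\<bar> * L2_norm g'"
proof -
  let ?d = "\<lambda>x. g (x + h *\<^sub>R b) - g x"
  have d: "?d \<in> L2_space" by (intro L2_space_diff L2_space_shift g)
  have "L2_norm ?d * L2_norm ?d = norm (L2_inner ?d ?d)"
    by (simp add: L2_inner_self[OF d] power2_eq_square abs_of_nonneg norm_mult)
  also have "\<dots> = \<bar>h\<bar> * norm (LINT s|lborel. indicator {0..1::real} s *\<^sub>R L2_inner (\<lambda>x. g' (x + s *\<^sub>R (h *\<^sub>R b))) ?d)"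
    by (subst weak_FTC_inner[OF g g' b w d]) (simp add: norm_mult)
  also have "\<dots> \<le> \<bar>h\<bar> * (L2_norm g' * L2_norm ?d)"
  proof (intro mult_left_mono norm_indicator_integral_le integrable_shift_inner g' d)
    show "norm (L2_inner (\<lambda>x. g' (x + s *\<^sub>R (h *\<^sub>R b))) ?d) \<le> L2_norm g' * L2_norm ?d" for s
      using L2_Cauchy_Schwarz[OF L2_space_shift[OF g'] d, of "s *\<^sub>R (h *\<^sub>R b)"] by (simp only: L2_norm_shift[OF g'])
  qed auto
  finally have le: "L2_norm ?d * L2_norm ?d \<le> (\<bar>h\<bar> * L2_norm g') * L2_norm ?d" by (simp add: mult.assoc)
  show ?thesis
  proof (cases "L2_norm ?d = 0")
    case False
    then have "0 < L2_norm ?d" using L2_norm_nonneg[of ?d] by linarith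
    then show ?thesis using le by (simp add: mult_le_cancel_right)
  qed simp
qed

text \<open>A first-order expansion with quadratic error. The shift inside the average is moved to
  g, which has a weak derivative and so changes by O(h) in norm; this replaces the continuity of
  translations on L^2 applied to f'.\<close>

lemma L2_inner_difference_quotient:
  assumes f: "f \<in> L2_space" and f': "f' \<in> L2_space" and g: "g \<in> L2_space" and g': "g' \<in> L2_space"
    and b: "b \<in> Basis" and wf: "has_weak_pderiv b f f'" and wg: "has_weak_pderiv b g g'"
  shows "norm (L2_inner (\<lambda>x. f (x + h *\<^sub>R b) - f x) g - of_real h * L2_inner f' g)
    \<le> h\<^sup>2 * (L2_norm f' * L2_norm g')"
proof -
  let ?F = "\<lambda>s. L2_inner (\<lambda>x. f' (x + s *\<^sub>R (h *\<^sub>R b))) g"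
  have int: "integrable lborel (\<lambda>s. indicator {0..1::real} s *\<^sub>R ?F s)"
    by (rule integrable_shift_inner[OF f' g])
  have int1: "integrable lborel (\<lambda>s. indicator {0..1::real} s *\<^sub>R L2_inner f' g)"
    by (rule borel_integrable_compact) auto
  have "(LINT s|lborel. indicator {0..1::real} s *\<^sub>R (?F s - L2_inner f' g))
      = (LINT s|lborel. indicator {0..1::real} s *\<^sub>R ?F s) - L2_inner f' g"
    using int int1 by (simp add: scaleR_diff_right)
  then have eq: "L2_inner (\<lambda>x. f (x + h *\<^sub>R b) - f x) g - of_real h * L2_inner f' g
      = of_real h * (LINT s|lborel. indicator {0..1::real} s *\<^sub>R (?F s - L2_inner f' g))"
    by (simp add: weak_FTC_inner[OF f f' b wf g] right_diff_distrib)
  have "norm (?F s - L2_inner f' g) \<le> \<bar>h\<bar> * (L2_norm f' * L2_norm g')" if s: "0 \<le> s" "s \<le> 1" for s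
  proof -
    have gs: "(\<lambda>x. g (x + (- s * h) *\<^sub>R b)) \<in> L2_space" by (rule L2_space_shift[OF g])
    \<comment> \<open>The translation passes to g with the opposite sign, and the Lipschitz bound
      for translates of g applies.\<close>
    have "?F s - L2_inner f' g = L2_inner f' (\<lambda>x. g (x + (- s * h) *\<^sub>R b) - g x)"
      by (subst L2_inner_diff_right[OF gs g f']) (simp add: L2_inner_shift[OF f' g])
    also have "norm \<dots> \<le> L2_norm f' * L2_norm (\<lambda>x. g (x + (- s * h) *\<^sub>R b) - g x)"
      by (intro L2_Cauchy_Schwarz f' L2_space_diff gs g)
    also have "\<dots> \<le> L2_norm f' * (\<bar>- s * h\<bar> * L2_norm g')"
      by (intro mult_left_mono L2_norm_shift_diff_le g g' b wg) simp
    also have "\<dots> \<le> L2_norm f' * (\<bar>h\<bar> * L2_norm g')"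
      using s by (intro mult_left_mono mult_right_mono) (auto simp: abs_mult mult_left_le_one_le)
    finally show ?thesis by (simp add: mult_ac)
  qed
  then have "norm (LINT s|lborel. indicator {0..1::real} s *\<^sub>R (?F s - L2_inner f' g))
      \<le> \<bar>h\<bar> * (L2_norm f' * L2_norm g')"
    using int int1 by (intro norm_indicator_integral_le) (auto simp: scaleR_diff_right)
  then have "\<bar>h\<bar> * norm (LINT s|lborel. indicator {0..1::real} s *\<^sub>R (?F s - L2_inner f' g))
      \<le> \<bar>h\<bar> * (\<bar>h\<bar> * (L2_norm f' * L2_norm g'))"
    by (rule mult_left_mono) simp
  then show ?thesis
    unfolding eq by (simp add: norm_mult power2_eq_square mult_ac)
qed

text \<open>
  Both sides are limits of \<open>h\<^sup>-\<^sup>1\<langle>f(\<cdot> + hb) - f, g\<rangle> = h\<^sup>-\<^sup>1\<langle>f, g(\<cdot> - hb) - g\<rangle>\<close>.  No density of test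
  functions in \<open>H\<^sup>1\<close> is needed.
\<close>

lemma weak_integration_by_parts:
  assumes f: "f \<in> L2_space" and f': "f' \<in> L2_space" and g: "g \<in> L2_space" and g': "g' \<in> L2_space"
    and b: "b \<in> Basis" and wf: "has_weak_pderiv b f f'" and wg: "has_weak_pderiv b g g'"
  shows "L2_inner f' g = - L2_inner f g'"
proof -
  let ?C = "2 * (L2_norm f' * L2_norm g')" and ?S = "L2_inner f' g + L2_inner f g'"
  have le: "norm ?S \<le> h * ?C" if h: "h > 0" for h :: real
  proof -
    have fs: "(\<lambda>x. f (x + h *\<^sub>R b)) \<in> L2_space" by (rule L2_space_shift[OF f])
    have gs: "(\<lambda>x. g (x + (- h) *\<^sub>R b)) \<in> L2_space" by (rule L2_space_shift[OF g])
    let ?X = "L2_inner (\<lambda>x. f (x + h *\<^sub>R b) - f x) g"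
    \<comment> \<open>The same number is an increment of f paired with g and, up to conjugation, an
      increment of g by -h paired with f, since <f,g> is subtracted in both. It can thus be expanded
      in two ways.\<close>
    have X: "?X = cnj (L2_inner (\<lambda>x. g (x + (- h) *\<^sub>R b) - g x) f)"
      unfolding L2_inner_diff_left[OF fs f g] L2_inner_diff_left[OF gs g f] complex_cnj_diff
        L2_inner_commute[of f, symmetric] L2_inner_shift[OF f g]
      by simp
    have 1: "norm (?X - of_real h * L2_inner f' g) \<le> h\<^sup>2 * (L2_norm f' * L2_norm g')"
      by (rule L2_inner_difference_quotient[OF f f' g g' b wf wg])
    have "norm (L2_inner (\<lambda>x. g (x + (- h) *\<^sub>R b) - g x) f - of_real (- h) * L2_inner g' f)
        \<le> (- h)\<^sup>2 * (L2_norm g' * L2_norm f')"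
      by (rule L2_inner_difference_quotient[OF g g' f f' b wg wf])
    then have "norm (cnj (L2_inner (\<lambda>x. g (x + (- h) *\<^sub>R b) - g x) f - of_real (- h) * L2_inner g' f))
        \<le> h\<^sup>2 * (L2_norm f' * L2_norm g')"
      by (simp only: complex_mod_cnj power2_minus mult.commute)
    then have 2: "norm (?X + of_real h * L2_inner f g') \<le> h\<^sup>2 * (L2_norm f' * L2_norm g')"
      by (simp add: X L2_inner_commute[of f g'])
    have "h * norm ?S = norm (of_real h * ?S)"
      using h by (simp add: norm_mult)
    \<comment> \<open>Subtracting the two expansions eliminates \<open>?X\<close>; the sum of the
      two pairings, multiplied by h, is then of order h^2.\<close>
    also have "of_real h * ?S = (?X + of_real h * L2_inner f g') - (?X - of_real h * L2_inner f' g)"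
      by (simp add: algebra_simps)
    also have "norm \<dots> \<le> norm (?X + of_real h * L2_inner f g') + norm (?X - of_real h * L2_inner f' g)"
      by (rule norm_triangle_ineq4)
    also have "\<dots> \<le> h * (h * ?C)" using 1 2 by (simp add: power2_eq_square algebra_simps)
    finally show ?thesis using h by (simp add: mult_le_cancel_left_pos)
  qed
  have "((\<lambda>h. h * ?C) \<longlongrightarrow> 0) (at_right 0)"
    by (intro tendsto_mult_left_zero tendsto_ident_at)
  moreover have "eventually (\<lambda>h. norm ?S \<le> h * ?C) (at_right 0)"
    using eventually_at_right_less[of "0::real"] by eventually_elim (rule le)
  ultimately have "norm ?S \<le> 0"
    by (intro tendsto_lowerbound) auto
  then show ?thesis by (simp add: eq_neg_iff_add_eq_0)
qed

section \<open>The concavity argument\<close>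

text \<open>The differential inequalities in isolation, with M the mass, F = -E, D the squared norm
  of u_t and c = cos(theta). Derivatives are assumed only inside the interval, so each monotonicity
  uses continuity up to the ends.\<close>

lemma concavity_blowup_bound:
  fixes M F J D :: "real \<Rightarrow> real"
  assumes \<alpha>: "0 < \<alpha>" and c: "0 < c" and T: "0 < T"
    and contM: "continuous_on {0..T} M" and contF: "continuous_on {0..T} F"
    and M0: "0 < M 0" and F0: "0 < F 0"
    and dM: "\<And>t. 0 < t \<Longrightarrow> t < T \<Longrightarrow> (M has_real_derivative 2 * c * J t) (at t)"
    and dF: "\<And>t. 0 < t \<Longrightarrow> t < T \<Longrightarrow> (F has_real_derivative c * D t) (at t)"
    and D: "\<And>t. 0 < t \<Longrightarrow> t < T \<Longrightarrow> 0 \<le> D t"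
    and JF: "\<And>t. 0 < t \<Longrightarrow> t < T \<Longrightarrow> (\<alpha> + 2) * F t \<le> J t"
    and JD: "\<And>t. 0 < t \<Longrightarrow> t < T \<Longrightarrow> (J t)\<^sup>2 \<le> M t * D t"
  shows "T \<le> M 0 / (\<alpha> * (\<alpha> + 2) * F 0 * c)"
proof -
  have Fge: "F 0 \<le> F t" if "t \<in> {0..T}" for t
    using DERIV_nonneg_imp_increasing_open[of 0 t F] that contF c D dF
    by (force intro: continuous_on_subset)
  \<comment> \<open>Positivity of J keeps M above its positive initial value, so that the negative
    powers below are differentiable; it also allows the lower bound on J to be multiplied by
    J.\<close>
  have Jpos: "0 < J t" if "0 < t" "t < T" for t
  proof -
    have "0 < (\<alpha> + 2) * F t" using Fge[of t] F0 \<alpha> that by auto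
    then show ?thesis using JF[OF that] by linarith
  qed
  have Mge: "M 0 \<le> M t" if "t \<in> {0..T}" for t
    using DERIV_nonneg_imp_increasing_open[of 0 t M] that contM c dM Jpos
    by (force intro: continuous_on_subset less_imp_le)
  have Mpos: "0 < M t" if "t \<in> {0..T}" for t
    using Mge[OF that] M0 by linarith
  \<comment> \<open>The exponent is dictated by the derivative of F M^(-p): its sign is that of M D
    - 2 p F J, and with 2 p = \<alpha> + 2 the bounds (\<alpha> + 2) F J \<le> J^2 \<le> M D match
    exactly.\<close>
  define p where "p = (\<alpha> + 2) / 2"
  have p: "p > 1" using \<alpha> by (simp add: p_def)
  define H where "H t = F t * M t powr (-p)" for t
  have contH: "continuous_on {0..T} H"
    unfolding H_def by (intro continuous_intros contM contF) (use Mpos in force)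
  have dH: "(H has_real_derivative (c * D t) * M t powr (-p) + F t * (- p * M t powr (-p - 1) * (2 * c * J t))) (at t)"
    if t: "0 < t" "t < T" for t
    unfolding H_def using Mpos[of t] t
    by (auto intro!: derivative_eq_intros dF dM)
  have dHnn: "0 \<le> (c * D t) * M t powr (-p) + F t * (- p * M t powr (-p - 1) * (2 * c * J t))"
    if t: "0 < t" "t < T" for t
  proof -
    have "F t * (\<alpha> + 2) * J t \<le> J t * J t"
      using JF[OF t] Jpos[OF t] by (simp add: mult.commute)
    also have "\<dots> \<le> M t * D t" using JD[OF t] by (simp add: power2_eq_square)
    finally have "0 \<le> M t * D t - 2 * p * F t * J t" by (simp add: p_def algebra_simps)
    then have "0 \<le> c * M t powr (-p-1) * (M t * D t - 2 * p * F t * J t)"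
      using c by (intro mult_nonneg_nonneg) auto
    moreover have "M t powr (-p) = M t powr (-p-1) * M t"
      using Mpos[of t] t powr_mult_base[of "M t" "-p - 1"] by (simp add: mult.commute)
    ultimately show ?thesis by (simp add: algebra_simps)
  qed
  have Hge: "H 0 \<le> H t" if "t \<in> {0..T}" for t
    using DERIV_nonneg_imp_increasing_open[of 0 t H] that contH dH dHnn
    by (force intro: continuous_on_subset)
  \<comment> \<open>Here q + 1 = p, so the derivative of -M^(-q) is \<alpha> c J M^(-p), which is at
    least \<alpha> (\<alpha> + 2) c H(t) and therefore at least the constant K. Monotonicity of L
    expresses the linear decrease of M^(-q).\<close>
  define q where "q = \<alpha> / 2"
  define K where "K = \<alpha> * (\<alpha> + 2) * c * H 0"
  define L where "L t = - (M t powr (-q)) - K * t" for t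
  have contL: "continuous_on {0..T} L"
    unfolding L_def by (intro continuous_intros contM) (use Mpos in force)
  have dL: "(L has_real_derivative q * M t powr (-q - 1) * (2 * c * J t) - K) (at t)"
    if t: "0 < t" "t < T" for t
    unfolding L_def using Mpos[of t] t
    by (auto intro!: derivative_eq_intros dM)
  have dLnn: "0 \<le> q * M t powr (-q - 1) * (2 * c * J t) - K" if t: "0 < t" "t < T" for t
  proof -
    have "K \<le> \<alpha> * (\<alpha> + 2) * c * H t"
      unfolding K_def using Hge[of t] t \<alpha> c by (intro mult_left_mono) auto
    also have "\<dots> = (\<alpha> * c * M t powr (-p)) * ((\<alpha> + 2) * F t)" by (simp add: H_def)
    also have "\<dots> \<le> (\<alpha> * c * M t powr (-p)) * J t"
      using JF[OF t] \<alpha> c by (intro mult_left_mono) auto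
    also have "\<dots> = q * M t powr (-q - 1) * (2 * c * J t)"
    proof -
      have "-q - 1 = -p" by (simp add: p_def q_def add_divide_distrib)
      then show ?thesis by (simp add: q_def)
    qed
    finally show ?thesis by simp
  qed
  have "L 0 \<le> L T"
    using DERIV_nonneg_imp_increasing_open[of 0 T L] T contL dL dLnn by force
  then have "- (M 0 powr (-q)) \<le> - (M T powr (-q)) - K * T"
    by (simp add: L_def)
  moreover have "0 \<le> M T powr (-q)" by simp
  ultimately have "K * T \<le> M 0 powr (-q)" by linarith
  \<comment> \<open>Because q = p - 1, the factor M(0)^(-p) contained in K cancels and M(0) to the
    first power remains.\<close>
  moreover have "M 0 powr (-q) = M 0 * M 0 powr (-p)"
    using M0 by (simp add: p_def q_def powr_mult_base add_divide_distrib)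
  ultimately have "(\<alpha> * (\<alpha> + 2) * F 0 * c * T) * M 0 powr (-p) \<le> M 0 * M 0 powr (-p)"
    by (simp add: K_def H_def mult_ac)
  then have "\<alpha> * (\<alpha> + 2) * F 0 * c * T \<le> M 0" using M0 by (simp add: mult_le_cancel_right)
  then show ?thesis using \<alpha> c F0 by (simp add: pos_le_divide_eq mult_ac)
qed

section \<open>The nonlinearity\<close>

definition power_nonlin :: "real \<Rightarrow> ('a \<Rightarrow> complex) \<Rightarrow> 'a \<Rightarrow> complex"
  where "power_nonlin \<alpha> w x = of_real (cmod (w x) powr \<alpha>) * w x"

definition power_energy :: "real \<Rightarrow> ('a::euclidean_space \<Rightarrow> complex) \<Rightarrow> real"
  where "power_energy \<alpha> w = (LINT x|lborel. cmod (w x) powr (\<alpha> + 2))"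

definition gradient_energy :: "('a::euclidean_space \<Rightarrow> complex) \<Rightarrow> real"
  where "gradient_energy w = (\<Sum>b\<in>Basis. (L2_norm (weak_pderiv b w))\<^sup>2)"

section \<open>Functions vanishing at infinity and the power nonlinearity\<close>

lemma C0_space_bounded:
  assumes "w \<in> C0_space"
  obtains K where "0 < K" "\<And>x. cmod (w x) \<le> K"
proof -
  from assms have cont: "continuous_on UNIV w" and lim: "(w \<longlongrightarrow> 0) at_infinity"
    by (auto simp: C0_space_def)
  from tendstoD[OF lim, of 1] obtain R where R: "\<And>x. R \<le> norm x \<Longrightarrow> norm (w x) < 1"
    by (auto simp: eventually_at_infinity)
  have "bounded (w ` cball 0 R)"
    by (intro compact_imp_bounded compact_continuous_image continuous_on_subset[OF cont]) auto
  then obtain B where B: "\<And>x. x \<in> cball 0 R \<Longrightarrow> norm (w x) \<le> B"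
    unfolding bounded_iff by blast
  show ?thesis
  proof (rule that[of "max 1 B"])
    show "cmod (w x) \<le> max 1 B" for x
      using R[of x] B[of x] by (cases "R \<le> norm x") (auto simp: less_imp_le le_max_iff_disj)
  qed simp
qed

lemma C0_space_diff: "w \<in> C0_space \<Longrightarrow> z \<in> C0_space \<Longrightarrow> (\<lambda>x. w x - z x) \<in> C0_space"
  unfolding C0_space_def by (auto intro!: continuous_intros tendsto_eq_intros)

lemma sup_norm_upper:
  assumes "w \<in> C0_space"
  shows "cmod (w x) \<le> sup_norm w"
proof -
  obtain K where "\<And>x. cmod (w x) \<le> K" using C0_space_bounded[OF assms] by blast
  then show ?thesis unfolding sup_norm_def by (intro cSUP_upper) (auto intro!: bdd_aboveI)
qed

lemma sup_norm_nonneg: "w \<in> C0_space \<Longrightarrow> 0 \<le> sup_norm w"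
  using sup_norm_upper[of w undefined] norm_ge_zero order_trans by blast

text \<open>A uniform bound on w places the nonlinearity in L^2 for every positive \<alpha>, so no
  Sobolev embedding and no growth restriction enters.\<close>

lemma power_nonlin_L2:
  assumes w: "w \<in> L2_space" and K: "\<And>x. cmod (w x) \<le> K" and \<alpha>: "0 < \<alpha>"
  shows "power_nonlin \<alpha> w \<in> L2_space" "L2_norm (power_nonlin \<alpha> w) \<le> K powr \<alpha> * L2_norm w"
proof -
  note [measurable] = L2_spaceD(1)[OF w]
  have m: "power_nonlin \<alpha> w \<in> borel_measurable borel" unfolding power_nonlin_def by measurable
  have le: "AE x in lborel. cmod (power_nonlin \<alpha> w x) \<le> K powr \<alpha> * cmod (w x)"
    using K \<alpha> by (auto simp: power_nonlin_def norm_mult intro!: mult_right_mono powr_mono2)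
  then show L2: "power_nonlin \<alpha> w \<in> L2_space" by (rule L2_space_AE_bound[OF w m])
  have "L2_norm (power_nonlin \<alpha> w) \<le> L2_norm (\<lambda>x. of_real (K powr \<alpha>) * w x)"
    using le by (intro L2_norm_mono_AE L2 L2_space_cmult w) (simp add: norm_mult)
  then show "L2_norm (power_nonlin \<alpha> w) \<le> K powr \<alpha> * L2_norm w" by (simp add: L2_norm_cmult)
qed

lemma power_nonlin_C0_L2:
  assumes "w \<in> C0_space" "w \<in> L2_space" "0 < \<alpha>"
  shows "power_nonlin \<alpha> w \<in> L2_space"
proof -
  obtain K where "\<And>x. cmod (w x) \<le> K" using C0_space_bounded[OF assms(1)] by blast
  then show ?thesis by (intro power_nonlin_L2 assms) auto
qed

lemma powr_add_2: "0 \<le> r \<Longrightarrow> r powr (\<alpha> + 2) = r powr \<alpha> * r\<^sup>2" for r :: real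
  by (cases "r = 0") (auto simp: powr_add)

lemma power_nonlin_mult_cnj: "power_nonlin \<alpha> w x * cnj (w x) = of_real (cmod (w x) powr (\<alpha> + 2))"
proof -
  have "w x * cnj (w x) = of_real ((cmod (w x))\<^sup>2)" by (rule complex_norm_square[symmetric])
  then show ?thesis by (simp only: power_nonlin_def powr_add_2 norm_ge_zero mult.assoc of_real_mult)
qed

lemma power_energy_integrable:
  assumes "w \<in> C0_space" "w \<in> L2_space" "0 < \<alpha>"
  shows "integrable lborel (\<lambda>x. cmod (w x) powr (\<alpha> + 2))"
proof -
  have "integrable lborel (\<lambda>x. power_nonlin \<alpha> w x * cnj (w x))"
    by (intro L2_inner_integrable power_nonlin_C0_L2 assms)
  then show ?thesis by (simp add: power_nonlin_mult_cnj complex_of_real_integrable_eq)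
qed

lemma power_nonlin_inner_self:
  "L2_inner (power_nonlin \<alpha> w) w = of_real (power_energy \<alpha> w)"
  by (simp add: L2_inner_def power_nonlin_mult_cnj power_energy_def)

text \<open>This is the tangent inequality, integrated, for the convex function |w|^(\<alpha>+2) /
  (\<alpha>+2), whose gradient is |w|^\<alpha> w. Exchanging w and z bounds the same increment from
  the other side.\<close>

lemma power_energy_convex:
  assumes \<alpha>: "0 < \<alpha>" and w: "w \<in> C0_space" "w \<in> L2_space" and z: "z \<in> C0_space" "z \<in> L2_space"
  shows "Re (L2_inner (power_nonlin \<alpha> w) (\<lambda>x. z x - w x))
    \<le> (power_energy \<alpha> z - power_energy \<alpha> w) / (\<alpha> + 2)"
proof -
  have pt: "Re (power_nonlin \<alpha> w x * cnj (z x - w x))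
      \<le> (cmod (z x) powr (\<alpha> + 2) - cmod (w x) powr (\<alpha> + 2)) / (\<alpha> + 2)" for x
  proof -
    let ?a = "cmod (z x)" and ?b = "cmod (w x)"
    have "Re (w x * cnj (z x)) \<le> ?b * ?a"
      using complex_Re_le_cmod[of "w x * cnj (z x)"] by (simp add: norm_mult)
    then have "?b powr \<alpha> * Re (w x * cnj (z x)) \<le> ?b powr \<alpha> * (?b * ?a)"
      by (rule mult_left_mono) simp
    moreover have "Re (power_nonlin \<alpha> w x * cnj (z x - w x))
        = ?b powr \<alpha> * Re (w x * cnj (z x)) - ?b powr (\<alpha> + 2)"
    proof -
      have "power_nonlin \<alpha> w x * cnj (z x - w x)
          = of_real (?b powr \<alpha>) * (w x * cnj (z x)) - power_nonlin \<alpha> w x * cnj (w x)"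
        by (simp add: power_nonlin_def algebra_simps)
      then show ?thesis by (simp only: power_nonlin_mult_cnj minus_complex.sel Re_complex_of_real
            times_complex.sel Im_complex_of_real mult_zero_left diff_zero)
    qed
    moreover have "?b powr \<alpha> * (?b * ?a) = ?a * ?b powr (\<alpha> + 1)"
      using powr_mult_base[of ?b \<alpha>] by (simp add: add.commute mult_ac)
    \<comment> \<open>Young's inequality with the conjugate exponents \<alpha> + 2 and (\<alpha> +
      2)/(\<alpha> + 1), which turn both factors into powers \<alpha> + 2. The second weight is 1 -
      1/(\<alpha> + 2) and combines with the term already present.\<close>
    moreover have "?a * ?b powr (\<alpha> + 1) \<le> ?a powr (\<alpha> + 2) / (\<alpha> + 2)
        + (?b powr (\<alpha> + 1)) powr ((\<alpha> + 2) / (\<alpha> + 1)) / ((\<alpha> + 2) / (\<alpha> + 1))"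
      using \<alpha> by (intro Youngs_inequality) (auto simp: field_simps)
    moreover have "(?b powr (\<alpha> + 1)) powr ((\<alpha> + 2) / (\<alpha> + 1)) = ?b powr (\<alpha> + 2)"
      using \<alpha> by (simp add: powr_powr)
    moreover have "B / ((\<alpha> + 2) / (\<alpha> + 1)) = B - B / (\<alpha> + 2)" for B
      using \<alpha> by (simp add: divide_simps) (simp add: algebra_simps)
    ultimately show ?thesis by (simp add: diff_divide_distrib)
  qed
  have int: "integrable lborel (\<lambda>x. power_nonlin \<alpha> w x * cnj (z x - w x))"
    by (intro L2_inner_integrable power_nonlin_C0_L2 L2_space_diff w z \<alpha>)
  have "Re (L2_inner (power_nonlin \<alpha> w) (\<lambda>x. z x - w x))
      = (LINT x|lborel. Re (power_nonlin \<alpha> w x * cnj (z x - w x)))"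
    unfolding L2_inner_def by (rule integral_Re[OF int, symmetric])
  also have "\<dots> \<le> (LINT x|lborel. (cmod (z x) powr (\<alpha> + 2) - cmod (w x) powr (\<alpha> + 2)) / (\<alpha> + 2))"
    using power_energy_integrable[OF w \<alpha>] power_energy_integrable[OF z \<alpha>]
    by (intro integral_mono integrable_Re int pt) auto
  also have "\<dots> = (power_energy \<alpha> z - power_energy \<alpha> w) / (\<alpha> + 2)"
    using power_energy_integrable[OF w \<alpha>] power_energy_integrable[OF z \<alpha>]
    by (simp add: power_energy_def)
  finally show ?thesis .
qed

section \<open>The energy\<close>

lemma energy_eq:
  assumes "w \<in> H1_space"
  shows "energy \<alpha> w = 1 / 2 * gradient_energy w - 1 / (\<alpha> + 2) * power_energy \<alpha> w"
proof -
  have "(LINT x|lborel. (\<Sum>b\<in>Basis. (cmod (weak_pderiv b w x))\<^sup>2))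
      = (\<Sum>b\<in>Basis. LINT x|lborel. (cmod (weak_pderiv b w x))\<^sup>2)"
    by (rule Bochner_Integration.integral_sum) (intro L2_spaceD(2) H1_spaceD(3) assms)
  then show ?thesis by (simp add: energy_def gradient_energy_def power_energy_def L2_norm_sq)
qed

lemma gradient_energy_nonneg: "0 \<le> gradient_energy w"
  by (simp add: gradient_energy_def sum_nonneg)

text \<open>The cross terms are conjugate to each other and their difference is purely imaginary.
  The identity is exact and linear in f - g, so dividing by a time increment leaves no remainder to
  estimate.\<close>

lemma L2_norm_sq_diff:
  assumes f: "f \<in> L2_space" and g: "g \<in> L2_space"
  shows "(L2_norm f)\<^sup>2 - (L2_norm g)\<^sup>2 = Re (L2_inner (\<lambda>x. f x - g x) (\<lambda>x. f x + g x))"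
proof -
  have "L2_inner (\<lambda>x. f x - g x) (\<lambda>x. f x + g x)
      = of_real ((L2_norm f)\<^sup>2) + L2_inner f g - (cnj (L2_inner f g) + of_real ((L2_norm g)\<^sup>2))"
    using f g L2_space_add[OF f g]
    by (simp add: L2_inner_diff_left L2_inner_add_right L2_inner_self L2_inner_commute[of g f])
  then show ?thesis by simp
qed

lemma H2_weak_laplacian_L2: "w \<in> H2_space \<Longrightarrow> weak_laplacian w \<in> L2_space"
  unfolding weak_laplacian_def[abs_def] by (intro L2_space_sum H1_spaceD H2_spaceD)

text \<open>Integration by parts takes the derivative off w - z. After division by the time
  increment only L^2 convergence of the difference quotient is then required, and the two Laplacians
  carry all the space derivatives.\<close>

lemma gradient_energy_diff:
  assumes w: "w \<in> H2_space" and z: "z \<in> H2_space"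
  shows "gradient_energy w - gradient_energy z
    = - Re (L2_inner (\<lambda>x. w x - z x) (\<lambda>x. weak_laplacian w x + weak_laplacian z x))"
proof -
  note H1 = H2_spaceD(1)[OF w] H2_spaceD(1)[OF z]
  note L2 = H1[THEN H1_spaceD(1)]
  let ?d = "\<lambda>x. w x - z x"
  let ?l = "\<lambda>b x. weak_pderiv b (weak_pderiv b w) x + weak_pderiv b (weak_pderiv b z) x"
  have d: "?d \<in> L2_space" by (intro L2_space_diff L2)
  have l: "?l b \<in> L2_space" if "b \<in> Basis" for b
    using that by (intro L2_space_add H1_spaceD H2_spaceD w z)
  have "(L2_norm (weak_pderiv b w))\<^sup>2 - (L2_norm (weak_pderiv b z))\<^sup>2 = - Re (L2_inner ?d (?l b))"
    if b: "b \<in> Basis" for b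
  proof -
    have "(L2_norm (weak_pderiv b w))\<^sup>2 - (L2_norm (weak_pderiv b z))\<^sup>2
        = Re (L2_inner (\<lambda>x. weak_pderiv b w x - weak_pderiv b z x) (\<lambda>x. weak_pderiv b w x + weak_pderiv b z x))"
      by (intro L2_norm_sq_diff H1_spaceD H1 b)
    also have "L2_inner (\<lambda>x. weak_pderiv b w x - weak_pderiv b z x) (\<lambda>x. weak_pderiv b w x + weak_pderiv b z x)
        = - L2_inner ?d (?l b)"
      by (intro weak_integration_by_parts[where b = b] d l b L2_space_diff L2_space_add
          has_weak_pderiv_diff has_weak_pderiv_add H1_spaceD H2_spaceD w z)
    finally show ?thesis by simp
  qed
  then have "gradient_energy w - gradient_energy z = (\<Sum>b\<in>Basis. - Re (L2_inner ?d (?l b)))"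
    by (simp add: gradient_energy_def sum_subtractf[symmetric])
  \<comment> \<open>Conjugation brings the summed terms into the left slot, for which additivity
    over finite sums is available.\<close>
  also have "\<dots> = - Re (cnj (\<Sum>b\<in>Basis. L2_inner (?l b) ?d))"
    by (simp add: sum_negf L2_inner_commute[of ?d])
  also have "(\<Sum>b\<in>Basis. L2_inner (?l b) ?d) = L2_inner (\<lambda>x. \<Sum>b\<in>Basis. ?l b x) ?d"
    by (rule L2_inner_sum_left[OF l d, symmetric])
  also have "cnj \<dots> = L2_inner ?d (\<lambda>x. \<Sum>b\<in>Basis. ?l b x)"
    by (rule L2_inner_commute[symmetric])
  finally show ?thesis by (simp add: weak_laplacian_def sum.distrib)
qed

lemma weak_laplacian_inner_self:
  assumes w: "w \<in> H2_space"
  shows "L2_inner (weak_laplacian w) w = - of_real (gradient_energy w)"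
proof -
  note H1 = H2_spaceD(1)[OF w]
  note L2 = H1_spaceD(1)[OF H1]
  have "L2_inner (weak_laplacian w) w = (\<Sum>b\<in>Basis. L2_inner (weak_pderiv b (weak_pderiv b w)) w)"
    unfolding weak_laplacian_def[abs_def]
    by (intro L2_inner_sum_left H1_spaceD H2_spaceD w)
  also have "\<dots> = (\<Sum>b\<in>Basis. - of_real ((L2_norm (weak_pderiv b w))\<^sup>2))"
  proof (rule sum.cong[OF refl])
    fix b :: 'a assume b: "b \<in> Basis"
    have "L2_inner (weak_pderiv b (weak_pderiv b w)) w = - L2_inner (weak_pderiv b w) (weak_pderiv b w)"
      by (intro weak_integration_by_parts[where b = b] b H1_spaceD H2_spaceD w)
    then show "L2_inner (weak_pderiv b (weak_pderiv b w)) w = - of_real ((L2_norm (weak_pderiv b w))\<^sup>2)"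
      using H1_spaceD(3)[OF H1 b] by (simp add: L2_inner_self)
  qed
  finally show ?thesis by (simp add: gradient_energy_def sum_negf)
qed

lemma L2_norm_le_H1_norm:
  "L2_norm w \<le> H1_norm w" "b \<in> Basis \<Longrightarrow> L2_norm (weak_pderiv b w) \<le> H1_norm w"
proof -
  have "L2_norm w = sqrt ((L2_norm w)\<^sup>2)" by simp
  also have "\<dots> \<le> H1_norm w" unfolding H1_norm_def by (intro real_sqrt_le_mono) (simp add: sum_nonneg)
  finally show "L2_norm w \<le> H1_norm w" .
  assume b: "b \<in> Basis"
  have "L2_norm (weak_pderiv b w) = sqrt ((L2_norm (weak_pderiv b w))\<^sup>2)" by simp
  also have "\<dots> \<le> H1_norm w" unfolding H1_norm_def
    using member_le_sum[of b Basis "\<lambda>b. (L2_norm (weak_pderiv b w))\<^sup>2"] b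
    by (intro real_sqrt_le_mono) (simp add: add_increasing)
  finally show "L2_norm (weak_pderiv b w) \<le> H1_norm w" .
qed

lemma L2_norm_le_H2_norm:
  assumes b: "b \<in> Basis" and c: "c \<in> Basis"
  shows "L2_norm (weak_pderiv c (weak_pderiv b w)) \<le> H2_norm w"
proof -
  have "(L2_norm (weak_pderiv c (weak_pderiv b w)))\<^sup>2 \<le> (\<Sum>c\<in>Basis. (L2_norm (weak_pderiv c (weak_pderiv b w)))\<^sup>2)"
    using member_le_sum[of c Basis "\<lambda>c. (L2_norm (weak_pderiv c (weak_pderiv b w)))\<^sup>2"] c by simp
  also have "\<dots> \<le> (\<Sum>b\<in>Basis. \<Sum>c\<in>Basis. (L2_norm (weak_pderiv c (weak_pderiv b w)))\<^sup>2)"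
    using member_le_sum[of b Basis "\<lambda>b. \<Sum>c\<in>Basis. (L2_norm (weak_pderiv c (weak_pderiv b w)))\<^sup>2"] b
    by (simp add: sum_nonneg)
  finally have "sqrt ((L2_norm (weak_pderiv c (weak_pderiv b w)))\<^sup>2) \<le> H2_norm w"
    unfolding H2_norm_def by (intro real_sqrt_le_mono) (simp add: add_increasing)
  then show ?thesis by simp
qed

lemma H1_norm_nonneg: "0 \<le> H1_norm w"
  by (simp add: H1_norm_def sum_nonneg)

section \<open>Evolution of mass and energy\<close>

lemma eventually_at_within_self: "eventually (\<lambda>s. s \<in> S) (at t within S)"
  by (simp add: eventually_at_filter)

lemma C0_H1_continuity:
  assumes u: "C_in S (C0_space \<inter> H1_space) (\<lambda>f. sup_norm f + H1_norm f) u" and t: "t \<in> S"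
  shows "((\<lambda>s. sup_norm (\<lambda>x. u s x - u t x)) \<longlongrightarrow> 0) (at t within S)"
    and "L2_lim u (u t) (at t within S)"
    and "b \<in> Basis \<Longrightarrow> L2_lim (\<lambda>s. weak_pderiv b (u s)) (weak_pderiv b (u t)) (at t within S)"
proof -
  have uS: "u s \<in> C0_space" "u s \<in> H1_space" if "s \<in> S" for s
    using u that by (auto simp: C_in_def)
  have lim: "((\<lambda>s. sup_norm (\<lambda>x. u s x - u t x) + H1_norm (\<lambda>x. u s x - u t x)) \<longlongrightarrow> 0) (at t within S)"
    using u t by (auto simp: C_in_def)
  note ev = eventually_at_within_self[of S t]
  \<comment> \<open>A supremum over a possibly unbounded set has no controlled sign, so
    nonnegativity is secured only for times in S, where the difference vanishes at infinity.\<close>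
  have sup0: "0 \<le> sup_norm (\<lambda>x. u s x - u t x)" if "s \<in> S" for s
    by (intro sup_norm_nonneg C0_space_diff uS t that)
  have *: "((\<lambda>s. F (\<lambda>x. u s x - u t x)) \<longlongrightarrow> 0) (at t within S)"
    if "\<And>w. F w \<le> H1_norm w" "\<And>w. 0 \<le> F w" for F :: "('a \<Rightarrow> complex) \<Rightarrow> real"
  proof (rule tendsto_sandwich[OF _ _ tendsto_const lim])
    show "eventually (\<lambda>s. F (\<lambda>x. u s x - u t x)
        \<le> sup_norm (\<lambda>x. u s x - u t x) + H1_norm (\<lambda>x. u s x - u t x)) (at t within S)"
      using ev by eventually_elim (use sup0 that(1) in \<open>simp add: add_increasing\<close>)
  qed (simp add: that(2))
  show "((\<lambda>s. sup_norm (\<lambda>x. u s x - u t x)) \<longlongrightarrow> 0) (at t within S)"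
  proof (rule tendsto_sandwich[OF _ _ tendsto_const lim])
    show "eventually (\<lambda>s. 0 \<le> sup_norm (\<lambda>x. u s x - u t x)) (at t within S)"
      using ev by eventually_elim (rule sup0)
  qed (simp add: H1_norm_nonneg)
  show "L2_lim u (u t) (at t within S)"
    unfolding L2_lim_def
  proof (intro conjI)
    show "eventually (\<lambda>s. u s \<in> L2_space) (at t within S)"
      using ev by eventually_elim (intro H1_spaceD uS)
    show "u t \<in> L2_space" by (intro H1_spaceD uS t)
    show "((\<lambda>s. L2_norm (\<lambda>x. u s x - u t x)) \<longlongrightarrow> 0) (at t within S)"
      by (intro * L2_norm_le_H1_norm L2_norm_nonneg)
  qed
  assume b: "b \<in> Basis"
  have L2: "weak_pderiv b (u s) \<in> L2_space" if "s \<in> S" for s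
    by (intro H1_spaceD uS that b)
  show "L2_lim (\<lambda>s. weak_pderiv b (u s)) (weak_pderiv b (u t)) (at t within S)"
  proof (rule L2_lim_boundI)
    show "eventually (\<lambda>s. weak_pderiv b (u s) \<in> L2_space) (at t within S)"
      using ev by eventually_elim (rule L2)
    show "weak_pderiv b (u t) \<in> L2_space" by (rule L2[OF t])
    show "((\<lambda>s. L2_norm (weak_pderiv b (\<lambda>x. u s x - u t x))) \<longlongrightarrow> 0) (at t within S)"
      by (intro * L2_norm_le_H1_norm b L2_norm_nonneg)
    show "eventually (\<lambda>s. L2_norm (\<lambda>x. weak_pderiv b (u s) x - weak_pderiv b (u t) x)
        \<le> L2_norm (weak_pderiv b (\<lambda>x. u s x - u t x))) (at t within S)"
      using ev
    proof eventually_elim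
      case (elim s)
      have "AE x in lborel. weak_pderiv b (u s) x - weak_pderiv b (u t) x = weak_pderiv b (\<lambda>x. u s x - u t x) x"
        using weak_pderiv_diff_AE[OF uS(2)[OF elim] uS(2)[OF t] b] by eventually_elim simp
      then show ?case
        by (intro eq_refl L2_norm_cong_AE L2_space_diff L2 elim t H1_spaceD H1_space_diff uS b)
    qed
  qed
qed

lemma power_energy_tendsto:
  assumes \<alpha>: "0 < \<alpha>"
    and u: "C_in S (C0_space \<inter> H1_space) (\<lambda>f. sup_norm f + H1_norm f) u" and t: "t \<in> S"
  shows "((\<lambda>s. power_energy \<alpha> (u s)) \<longlongrightarrow> power_energy \<alpha> (u t)) (at t within S)"
proof -
  have uS: "u s \<in> C0_space" "u s \<in> L2_space" if "s \<in> S" for s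
    using u that by (auto simp: C_in_def intro: H1_spaceD)
  note lim = C0_H1_continuity(1,2)[OF u t]
  obtain K where K: "\<And>x. cmod (u t x) \<le> K" using C0_space_bounded[OF uS(1)[OF t]] by blast
  let ?d = "\<lambda>s x. u s x - u t x"
  let ?B = "\<lambda>s. (\<alpha> + 2) * ((K + 1) powr \<alpha> * (L2_norm (u s) + L2_norm (u t)) * L2_norm (?d s))"
  have dlim: "((\<lambda>s. L2_norm (?d s)) \<longlongrightarrow> 0) (at t within S)"
    using lim(2) by (simp add: L2_lim_def)
  have "((\<lambda>s. power_energy \<alpha> (u s) - power_energy \<alpha> (u t)) \<longlongrightarrow> 0) (at t within S)"
  proof (rule Lim_null_comparison)
    have "(?B \<longlongrightarrow> (\<alpha> + 2) * ((K + 1) powr \<alpha> * (L2_norm (u t) + L2_norm (u t)) * 0)) (at t within S)"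
      by (intro tendsto_intros L2_lim_norm[OF lim(2)] dlim)
    then show "(?B \<longlongrightarrow> 0) (at t within S)" by simp
    \<comment> \<open>Within sup distance 1 of u(t) the states share the bound K + 1, which explains
      the constant in \<open>?B\<close>.\<close>
    have "eventually (\<lambda>s. sup_norm (?d s) < 1) (at t within S)"
      by (rule order_tendstoD(2)[OF lim(1)]) simp
    then show "eventually (\<lambda>s. norm (power_energy \<alpha> (u s) - power_energy \<alpha> (u t)) \<le> ?B s) (at t within S)"
      using eventually_at_within_self[of S t]
    proof eventually_elim
      case (elim s)
      note us = uS[OF elim(2)] and ut = uS[OF t]
      have d: "?d s \<in> L2_space" "(\<lambda>x. u t x - u s x) \<in> L2_space" by (intro L2_space_diff us ut)+
      have Kt: "cmod (u t x) \<le> K + 1" for x using K[of x] by simp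
      have Ks: "cmod (u s x) \<le> K + 1" for x
      proof -
        have "cmod (u s x) \<le> cmod (u t x) + cmod (u s x - u t x)"
          by (metis add.commute norm_triangle_sub)
        also have "cmod (u s x - u t x) \<le> sup_norm (?d s)"
          using sup_norm_upper[OF C0_space_diff[OF us(1) ut(1)], of x] by simp
        finally show ?thesis using K[of x] elim(1) by simp
      qed
      have n: "0 \<le> (K + 1) powr \<alpha> * L2_norm w" for w :: "'a \<Rightarrow> complex" by simp
      have "norm (L2_inner (power_nonlin \<alpha> (u t)) (?d s)) \<le> L2_norm (power_nonlin \<alpha> (u t)) * L2_norm (?d s)"
        by (intro L2_Cauchy_Schwarz d power_nonlin_C0_L2 ut \<alpha>)
      also have "\<dots> \<le> ((K + 1) powr \<alpha> * L2_norm (u t)) * L2_norm (?d s)"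
        by (intro mult_right_mono power_nonlin_L2 ut Kt \<alpha> L2_norm_nonneg)
      finally have 1: "- (((K + 1) powr \<alpha> * L2_norm (u t)) * L2_norm (?d s))
          \<le> Re (L2_inner (power_nonlin \<alpha> (u t)) (?d s))"
        using abs_Re_le_cmod[of "L2_inner (power_nonlin \<alpha> (u t)) (?d s)"] by linarith
      have "norm (L2_inner (power_nonlin \<alpha> (u s)) (\<lambda>x. u t x - u s x))
          \<le> L2_norm (power_nonlin \<alpha> (u s)) * L2_norm (?d s)"
        using L2_Cauchy_Schwarz[OF power_nonlin_C0_L2[OF us \<alpha>] d(2)]
        by (simp add: L2_norm_diff_commute[of "u t"])
      also have "\<dots> \<le> ((K + 1) powr \<alpha> * L2_norm (u s)) * L2_norm (?d s)"
        by (intro mult_right_mono power_nonlin_L2 us Ks \<alpha> L2_norm_nonneg)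
      finally have 2: "- (((K + 1) powr \<alpha> * L2_norm (u s)) * L2_norm (?d s))
          \<le> Re (L2_inner (power_nonlin \<alpha> (u s)) (\<lambda>x. u t x - u s x))"
        using abs_Re_le_cmod[of "L2_inner (power_nonlin \<alpha> (u s)) (\<lambda>x. u t x - u s x)"] by linarith
      let ?X = "(K + 1) powr \<alpha> * (L2_norm (u s) + L2_norm (u t)) * L2_norm (?d s)"
      have nn: "0 \<le> (K + 1) powr \<alpha> * L2_norm (u s) * L2_norm (?d s)"
        "0 \<le> (K + 1) powr \<alpha> * L2_norm (u t) * L2_norm (?d s)" by simp_all
      have X: "?X = (K + 1) powr \<alpha> * L2_norm (u s) * L2_norm (?d s)
          + (K + 1) powr \<alpha> * L2_norm (u t) * L2_norm (?d s)" by (simp add: algebra_simps)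
      \<comment> \<open>The tangent at u(t) gives the lower bound on the increment, the tangent at
        u(s) the upper one; both are weakened to the common bound \<open>?X\<close>.\<close>
      have a: "- ?X \<le> (power_energy \<alpha> (u s) - power_energy \<alpha> (u t)) / (\<alpha> + 2)"
        using power_energy_convex[OF \<alpha> ut us] 1 nn X by linarith
      have b: "- ?X \<le> (power_energy \<alpha> (u t) - power_energy \<alpha> (u s)) / (\<alpha> + 2)"
        using power_energy_convex[OF \<alpha> us ut] 2 nn X by linarith
      have "\<bar>power_energy \<alpha> (u s) - power_energy \<alpha> (u t)\<bar> / (\<alpha> + 2) \<le> ?X"
        using a b \<alpha> by (auto simp: abs_if diff_divide_distrib)
      then show ?case using \<alpha> by (simp add: pos_divide_le_eq mult.commute)
    qed
  qed
  then show ?thesis using Lim_null by blast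
qed

section \<open>Continuity of mass, energy and Laplacian in time\<close>

lemma mass_continuous:
  assumes u: "C_in S (C0_space \<inter> H1_space) (\<lambda>f. sup_norm f + H1_norm f) u"
  shows "continuous_on S (\<lambda>t. (L2_norm (u t))\<^sup>2)"
  unfolding continuous_on_def
  by (intro ballI tendsto_power L2_lim_norm C0_H1_continuity[OF u])

text \<open>With S the closed time interval this includes time 0, which links the derivative of the
  energy at interior times to the negative initial energy.\<close>

lemma energy_continuous:
  assumes \<alpha>: "0 < \<alpha>" and u: "C_in S (C0_space \<inter> H1_space) (\<lambda>f. sup_norm f + H1_norm f) u"
  shows "continuous_on S (\<lambda>t. energy \<alpha> (u t))"
proof -
  have "continuous_on S (\<lambda>t. 1 / 2 * gradient_energy (u t) - 1 / (\<alpha> + 2) * power_energy \<alpha> (u t))"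
    unfolding continuous_on_def gradient_energy_def
    by (intro ballI tendsto_diff tendsto_mult tendsto_const tendsto_sum tendsto_power
        L2_lim_norm C0_H1_continuity[OF u] power_energy_tendsto[OF \<alpha> u])
  then show ?thesis
    by (rule continuous_on_eq) (use u in \<open>auto simp: C_in_def energy_eq\<close>)
qed

lemma weak_laplacian_L2_lim:
  assumes u: "C_in S H2_space H2_norm u" and t: "t \<in> S"
  shows "L2_lim (\<lambda>s. weak_laplacian (u s)) (weak_laplacian (u t)) (at t within S)"
  unfolding weak_laplacian_def[abs_def]
proof (rule L2_lim_sum, rule L2_lim_boundI)
  fix b :: 'a assume b: "b \<in> Basis"
  note ev = eventually_at_within_self[of S t]
  have uS: "u s \<in> H2_space" if "s \<in> S" for s using u that by (auto simp: C_in_def)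
  have L2: "weak_pderiv b (weak_pderiv b (u s)) \<in> L2_space" if "s \<in> S" for s
    by (intro H1_spaceD H2_spaceD uS that b)
  show "eventually (\<lambda>s. weak_pderiv b (weak_pderiv b (u s)) \<in> L2_space) (at t within S)"
    using ev by eventually_elim (rule L2)
  show "weak_pderiv b (weak_pderiv b (u t)) \<in> L2_space" by (rule L2[OF t])
  show "((\<lambda>s. H2_norm (\<lambda>x. u s x - u t x)) \<longlongrightarrow> 0) (at t within S)"
    using u t by (auto simp: C_in_def)
  show "eventually (\<lambda>s. L2_norm (\<lambda>x. weak_pderiv b (weak_pderiv b (u s)) x - weak_pderiv b (weak_pderiv b (u t)) x)
      \<le> H2_norm (\<lambda>x. u s x - u t x)) (at t within S)"
    using ev
  proof eventually_elim
    case (elim s)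
    \<comment> \<open>This is the second derivative that occurs in \<open>H2_norm\<close> of the
      difference. It agrees only almost everywhere with the difference of the chosen second
      derivatives, so its membership in L^2 has to be transferred as well.\<close>
    let ?w = "weak_pderiv b (weak_pderiv b (\<lambda>x. u s x - u t x))"
    have eq: "AE x in lborel. ?w x = weak_pderiv b (weak_pderiv b (u s)) x - weak_pderiv b (weak_pderiv b (u t)) x"
      by (intro H2_weak_pderiv_diff_AE uS elim t b)
    have d: "(\<lambda>x. weak_pderiv b (weak_pderiv b (u s)) x - weak_pderiv b (weak_pderiv b (u t)) x) \<in> L2_space"
      by (intro L2_space_diff L2 elim t)
    have "has_weak_pderiv b (weak_pderiv b (\<lambda>x. u s x - u t x)) ?w"
    proof (rule has_weak_pderiv_weak_pderiv)
      show "has_weak_pderiv b (weak_pderiv b (\<lambda>x. u s x - u t x))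
          (\<lambda>x. weak_pderiv b (weak_pderiv b (u s)) x - weak_pderiv b (weak_pderiv b (u t)) x)"
        by (intro H2_has_weak_pderiv_diff uS elim t b)
    qed
    then have "?w \<in> L2_space"
      using locally_integrable_measurable
      by (intro L2_space_cong_AE[OF d _ eq]) (auto simp: has_weak_pderiv_def)
    then have "L2_norm (\<lambda>x. weak_pderiv b (weak_pderiv b (u s)) x - weak_pderiv b (weak_pderiv b (u t)) x) = L2_norm ?w"
      using L2_norm_cong_AE[OF _ d eq] by simp
    then show ?case using L2_norm_le_H2_norm[OF b b, of "\<lambda>x. u s x - u t x"] by simp
  qed
qed

text \<open>One interior time t is fixed, but the equation and the derivative are assumed at all
  interior times: limits as s tends to t use the equation at s as well.\<close>

locale interior_time =
  fixes \<alpha> \<theta> T t :: real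
    and u v :: "real \<Rightarrow> 'a::euclidean_space \<Rightarrow> complex"
  assumes \<alpha>: "0 < \<alpha>" and t: "t \<in> {0<..<T}"
    and uC: "C_in {0..T} (C0_space \<inter> H1_space) (\<lambda>f. sup_norm f + H1_norm f) u"
    and uH2: "C_in {0<..<T} H2_space H2_norm u"
    and vL2: "C_in {0<..<T} L2_space L2_norm v"
    and deriv: "\<And>t. t \<in> {0<..<T} \<Longrightarrow> has_L2_deriv u (v t) t"
    and equation: "\<And>t. t \<in> {0<..<T} \<Longrightarrow> AE x in lborel. cis (- \<theta>) * v t x =
      weak_laplacian (u t) x + of_real (cmod (u t x) powr \<alpha>) * u t x"
begin

section \<open>Limits and derivatives at an interior time\<close>

abbreviation "dquot s \<equiv> (\<lambda>x. (u s x - u t x) / of_real (s - t))"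

lemma in_spaces:
  assumes "s \<in> {0<..<T}"
  shows "u s \<in> C0_space" "u s \<in> L2_space" "u s \<in> H2_space" "v s \<in> L2_space"
    "weak_laplacian (u s) \<in> L2_space" "power_nonlin \<alpha> (u s) \<in> L2_space"
proof -
  have 1: "u s \<in> C0_space" "u s \<in> H1_space" using uC assms by (auto simp: C_in_def)
  then show 2: "u s \<in> C0_space" "u s \<in> L2_space" by (auto intro: H1_spaceD)
  show "u s \<in> H2_space" using uH2 assms by (auto simp: C_in_def)
  then show "weak_laplacian (u s) \<in> L2_space" by (rule H2_weak_laplacian_L2)
  show "v s \<in> L2_space" using vL2 assms by (auto simp: C_in_def)
  show "power_nonlin \<alpha> (u s) \<in> L2_space" by (intro power_nonlin_C0_L2 2 \<alpha>)
qed

lemma at_t: "at t within {0<..<T} = at t" "at t within {0..T} = at t"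
  using t by (auto intro!: at_within_open at_within_interior)

lemma eventually_interior: "eventually (\<lambda>s. s \<in> {0<..<T} \<and> s \<noteq> t) (at t)"
  using eventually_at_within_self[of "{0<..<T}" t] eventually_neq_at_within[of t t UNIV]
  unfolding at_t by eventually_elim simp

lemma v_eq: "s \<in> {0<..<T} \<Longrightarrow>
    AE x in lborel. cis (- \<theta>) * v s x = weak_laplacian (u s) x + power_nonlin \<alpha> (u s) x"
  using equation by (simp add: power_nonlin_def)

lemma quotient_L2: "s \<in> {0<..<T} \<Longrightarrow> dquot s \<in> L2_space"
  by (intro L2_space_divide L2_space_diff in_spaces t)

lemma L2_lim_u: "L2_lim u (u t) (at t)"
  using C0_H1_continuity(2)[OF uC, of t] t unfolding at_t by simp

lemma L2_lim_laplacian: "L2_lim (\<lambda>s. weak_laplacian (u s)) (weak_laplacian (u t)) (at t)"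
  using weak_laplacian_L2_lim[OF uH2 t] by (simp add: at_t)

lemma L2_lim_v: "L2_lim v (v t) (at t)"
  unfolding L2_lim_def
proof (intro conjI)
  show "eventually (\<lambda>s. v s \<in> L2_space) (at t)"
    using eventually_interior by eventually_elim (rule in_spaces, simp)
  show "v t \<in> L2_space" by (rule in_spaces[OF t])
  show "((\<lambda>s. L2_norm (\<lambda>x. v s x - v t x)) \<longlongrightarrow> 0) (at t)"
    using vL2 t unfolding C_in_def at_t(1)[symmetric] by blast
qed

lemma L2_lim_quotient: "L2_lim dquot (v t) (at t)"
  unfolding L2_lim_def
proof (intro conjI)
  show "eventually (\<lambda>s. dquot s \<in> L2_space) (at t)"
    using eventually_interior by eventually_elim (rule quotient_L2, simp)
  show "v t \<in> L2_space" by (rule in_spaces[OF t])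
  show "((\<lambda>s. L2_norm (\<lambda>x. dquot s x - v t x)) \<longlongrightarrow> 0) (at t)"
    using deriv[OF t] by (simp add: has_L2_deriv_def)
qed

text \<open>The equation itself yields the continuity of \<open>|u|\<^sup>\<alpha>u\<close> in \<open>L\<^sup>2\<close>.\<close>

lemma L2_lim_power_nonlin: "L2_lim (\<lambda>s. power_nonlin \<alpha> (u s)) (power_nonlin \<alpha> (u t)) (at t)"
proof (rule L2_lim_cong_AE)
  show "L2_lim (\<lambda>s x. cis (- \<theta>) * v s x - weak_laplacian (u s) x)
      (\<lambda>x. cis (- \<theta>) * v t x - weak_laplacian (u t) x) (at t)"
    by (intro L2_lim_diff L2_lim_cmult L2_lim_v L2_lim_laplacian)
  show "eventually (\<lambda>s. power_nonlin \<alpha> (u s) \<in> L2_space) (at t)"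
    using eventually_interior by eventually_elim (rule in_spaces, simp)
  show "power_nonlin \<alpha> (u t) \<in> L2_space" by (rule in_spaces[OF t])
  have eq: "AE x in lborel. cis (- \<theta>) * v s x - weak_laplacian (u s) x = power_nonlin \<alpha> (u s) x"
    if "s \<in> {0<..<T}" for s
    using v_eq[OF that] by eventually_elim simp
  show "eventually (\<lambda>s. AE x in lborel. cis (- \<theta>) * v s x - weak_laplacian (u s) x
      = power_nonlin \<alpha> (u s) x) (at t)"
    by (rule eventually_mono[OF eventually_interior]) (use eq in blast)
  show "AE x in lborel. cis (- \<theta>) * v t x - weak_laplacian (u t) x = power_nonlin \<alpha> (u t) x"
    by (rule eq[OF t])
qed

text \<open>The quotient of squared norms equals the real part of the pairing of
  \<open>dquot s\<close> with u(s) + u(t); both factors converge in L^2.\<close>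

lemma mass_has_derivative:
  "((\<lambda>s. (L2_norm (u s))\<^sup>2) has_real_derivative 2 * Re (L2_inner (v t) (u t))) (at t)"
  unfolding has_field_derivative_iff
proof (rule Lim_transform_eventually)
  have "L2_inner (v t) (\<lambda>x. u t x + u t x) = L2_inner (v t) (u t) + L2_inner (v t) (u t)"
    by (intro L2_inner_add_right in_spaces t)
  moreover have "((\<lambda>s. Re (L2_inner (dquot s) (\<lambda>x. u s x + u t x)))
      \<longlongrightarrow> Re (L2_inner (v t) (\<lambda>x. u t x + u t x))) (at t)"
    by (intro tendsto_Re L2_lim_inner L2_lim_quotient L2_lim_add L2_lim_u L2_lim_const in_spaces t)
  ultimately show "((\<lambda>s. Re (L2_inner (dquot s) (\<lambda>x. u s x + u t x)))
      \<longlongrightarrow> 2 * Re (L2_inner (v t) (u t))) (at t)"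
    by simp
  show "eventually (\<lambda>s. Re (L2_inner (dquot s) (\<lambda>x. u s x + u t x))
      = ((L2_norm (u s))\<^sup>2 - (L2_norm (u t))\<^sup>2) / (s - t)) (at t)"
    using eventually_interior
  proof eventually_elim
    case (elim s)
    then have s: "s \<in> {0<..<T}" by simp
    show ?case
      unfolding L2_inner_divide_left Re_divide_of_real
        L2_norm_sq_diff[OF in_spaces(2)[OF s] in_spaces(2)[OF t]] ..
  qed
qed

text \<open>After integration by parts the quotient is a pairing of \<open>dquot s\<close> with the
  sum of the Laplacians at s and t. Continuity in H^2 makes this sum converge in L^2, so no time
  derivative of the gradient is involved.\<close>

lemma gradient_energy_has_derivative:
  "(gradient_energy \<circ> u has_real_derivative - 2 * Re (L2_inner (v t) (weak_laplacian (u t)))) (at t)"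
  unfolding has_field_derivative_iff
proof (rule Lim_transform_eventually)
  let ?l = "\<lambda>s x. weak_laplacian (u s) x + weak_laplacian (u t) x"
  have "L2_inner (v t) (?l t) = L2_inner (v t) (weak_laplacian (u t)) + L2_inner (v t) (weak_laplacian (u t))"
    by (intro L2_inner_add_right in_spaces t)
  moreover have "((\<lambda>s. - Re (L2_inner (dquot s) (?l s))) \<longlongrightarrow> - Re (L2_inner (v t) (?l t))) (at t)"
    by (intro tendsto_minus tendsto_Re L2_lim_inner L2_lim_quotient L2_lim_add L2_lim_laplacian
        L2_lim_const in_spaces t)
  ultimately show "((\<lambda>s. - Re (L2_inner (dquot s) (?l s)))
      \<longlongrightarrow> - 2 * Re (L2_inner (v t) (weak_laplacian (u t)))) (at t)"
    by simp
  show "eventually (\<lambda>s. - Re (L2_inner (dquot s) (?l s))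
      = ((gradient_energy \<circ> u) s - (gradient_energy \<circ> u) t) / (s - t)) (at t)"
    using eventually_interior
  proof eventually_elim
    case (elim s)
    then have s: "s \<in> {0<..<T}" by simp
    show ?case
      unfolding L2_inner_divide_left Re_divide_of_real comp_def
        gradient_energy_diff[OF in_spaces(3)[OF s] in_spaces(3)[OF t]] by simp
  qed
qed

text \<open>
  By convexity the difference quotient lies between the pairings of \<open>dquot s\<close> with \<open>|u|\<^sup>\<alpha>u\<close> at
  the times \<open>t\<close> and \<open>s\<close>.
\<close>

lemma power_energy_has_derivative:
  "((\<lambda>s. power_energy \<alpha> (u s) / (\<alpha> + 2)) has_real_derivative
    Re (L2_inner (power_nonlin \<alpha> (u t)) (v t))) (at t)"
  unfolding has_field_derivative_iff
proof -
  let ?g = "\<lambda>s. power_nonlin \<alpha> (u s)"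
  let ?Q = "\<lambda>s. (power_energy \<alpha> (u s) / (\<alpha> + 2) - power_energy \<alpha> (u t) / (\<alpha> + 2)) / (s - t)"
  let ?L = "\<lambda>s. Re (L2_inner (?g t) (dquot s))" and ?R = "\<lambda>s. Re (L2_inner (?g s) (dquot s))"
  have L: "(?L \<longlongrightarrow> Re (L2_inner (?g t) (v t))) (at t)"
    by (intro tendsto_Re L2_lim_inner L2_lim_quotient L2_lim_const in_spaces t)
  have R: "(?R \<longlongrightarrow> Re (L2_inner (?g t) (v t))) (at t)"
    by (intro tendsto_Re L2_lim_inner L2_lim_quotient L2_lim_power_nonlin)
  \<comment> \<open>Which of the two pairings is the lower bound depends on the sign of s - t;
    minimum and maximum treat both sides of t at once.\<close>
  have "((\<lambda>s. min (?L s) (?R s)) \<longlongrightarrow> min (Re (L2_inner (?g t) (v t))) (Re (L2_inner (?g t) (v t)))) (at t)"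
    by (intro tendsto_min L R)
  then have lo: "((\<lambda>s. min (?L s) (?R s)) \<longlongrightarrow> Re (L2_inner (?g t) (v t))) (at t)" by simp
  have "((\<lambda>s. max (?L s) (?R s)) \<longlongrightarrow> max (Re (L2_inner (?g t) (v t))) (Re (L2_inner (?g t) (v t)))) (at t)"
    by (intro tendsto_max L R)
  then have hi: "((\<lambda>s. max (?L s) (?R s)) \<longlongrightarrow> Re (L2_inner (?g t) (v t))) (at t)" by simp
  have "eventually (\<lambda>s. min (?L s) (?R s) \<le> ?Q s \<and> ?Q s \<le> max (?L s) (?R s)) (at t)"
    using eventually_interior
  proof eventually_elim
    case (elim s)
    then have s: "s \<in> {0<..<T}" and ne: "s \<noteq> t" by auto
    let ?P = "power_energy \<alpha> (u s) / (\<alpha> + 2) - power_energy \<alpha> (u t) / (\<alpha> + 2)"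
    have d: "Re (L2_inner w (dquot s)) = Re (L2_inner w (\<lambda>x. u s x - u t x)) / (s - t)" for w
    proof -
      have "L2_inner w (dquot s) = L2_inner w (\<lambda>x. u s x - u t x) / of_real (s - t)"
        unfolding L2_inner_commute[of w] L2_inner_divide_left by simp
      then show ?thesis by (simp only: Re_divide_of_real)
    qed
    have lower: "Re (L2_inner (?g t) (\<lambda>x. u s x - u t x)) \<le> ?P"
      using power_energy_convex[OF \<alpha>, of "u t" "u s"] in_spaces[OF s] in_spaces[OF t]
      by (simp add: diff_divide_distrib)
    have "Re (L2_inner (?g s) (\<lambda>x. u t x - u s x)) \<le> - ?P"
      using power_energy_convex[OF \<alpha>, of "u s" "u t"] in_spaces[OF s] in_spaces[OF t]
      by (simp add: diff_divide_distrib)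
    moreover have "L2_inner (?g s) (\<lambda>x. u t x - u s x) = - L2_inner (?g s) (\<lambda>x. u s x - u t x)"
      using in_spaces[OF s] in_spaces[OF t] by (simp add: L2_inner_diff_right)
    ultimately have upper: "?P \<le> Re (L2_inner (?g s) (\<lambda>x. u s x - u t x))" by simp
    show ?case
    proof (cases "t < s")
      case True
      then have "?L s \<le> ?Q s" "?Q s \<le> ?R s"
        unfolding d using lower upper by (intro divide_right_mono; simp)+
      then show ?thesis by auto
    next
      case False
      then have "?Q s \<le> ?L s" "?R s \<le> ?Q s"
        unfolding d using lower upper by (intro divide_right_mono_neg; simp)+
      then show ?thesis by auto
    qed
  qed
  then have "eventually (\<lambda>s. min (?L s) (?R s) \<le> ?Q s) (at t)" "eventually (\<lambda>s. ?Q s \<le> max (?L s) (?R s)) (at t)"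
    by (auto elim: eventually_mono)
  then show "(?Q \<longlongrightarrow> Re (L2_inner (?g t) (v t))) (at t)"
    by (rule tendsto_sandwich[OF _ _ lo hi])
qed

text \<open>The derivative of the energy is minus the real part of the pairing of the right-hand
  side of the equation with v. The right-hand side is e^(-i theta) v, and the real part of this
  phase is cos(theta).\<close>

lemma energy_has_derivative:
  "((\<lambda>s. energy \<alpha> (u s)) has_real_derivative - cos \<theta> * (L2_norm (v t))\<^sup>2) (at t)"
proof -
  let ?l = "weak_laplacian (u t)" and ?g = "power_nonlin \<alpha> (u t)"
  note L2 = in_spaces[OF t]
  have d: "((\<lambda>s. 1 / 2 * (gradient_energy \<circ> u) s - power_energy \<alpha> (u s) / (\<alpha> + 2)) has_real_derivative
      1 / 2 * (- 2 * Re (L2_inner (v t) ?l)) - Re (L2_inner ?g (v t))) (at t)"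
    by (intro DERIV_diff DERIV_cmult gradient_energy_has_derivative power_energy_has_derivative)
  have "L2_inner (\<lambda>x. ?l x + ?g x) (v t) = L2_inner (\<lambda>x. cis (- \<theta>) * v t x) (v t)"
    using v_eq[OF t] by (intro L2_inner_cong_AE L2_space_add L2_space_cmult L2) (auto elim: eventually_mono)
  then have "L2_inner ?l (v t) + L2_inner ?g (v t) = cis (- \<theta>) * of_real ((L2_norm (v t))\<^sup>2)"
    using L2 by (simp add: L2_inner_add_left L2_inner_cmult_left L2_inner_self)
  then have "Re (L2_inner ?l (v t)) + Re (L2_inner ?g (v t)) = cos \<theta> * (L2_norm (v t))\<^sup>2"
    by (simp add: complex_eq_iff del: of_real_power)
  moreover have "Re (L2_inner (v t) ?l) = Re (L2_inner ?l (v t))"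
    using L2_inner_commute[of "v t" ?l] by simp
  ultimately have "1 / 2 * (- 2 * Re (L2_inner (v t) ?l)) - Re (L2_inner ?g (v t))
      = - cos \<theta> * (L2_norm (v t))\<^sup>2"
    by simp
  \<comment> \<open>The splitting of the energy into its two parts is known only for states in H^1,
    so the derivative is transferred on the open interval of interior times.\<close>
  from d[unfolded this] show ?thesis
  proof (rule has_field_derivative_transform_within_open[of _ _ _ "{0<..<T}"])
    show "1 / 2 * (gradient_energy \<circ> u) s - power_energy \<alpha> (u s) / (\<alpha> + 2) = energy \<alpha> (u s)"
      if "s \<in> {0<..<T}" for s
      using energy_eq[OF H2_spaceD(1)[OF in_spaces(3)[OF that]]] by simp
  qed (use t in auto)
qed

text \<open>Solved for v and paired with u, the equation gives two real pairings, so the phase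
  factors out completely. Its real part yields the derivative of the mass, its modulus the sharp
  Cauchy-Schwarz bound.\<close>

lemma v_inner_u:
  "L2_inner (v t) (u t) = cis \<theta> * of_real (power_energy \<alpha> (u t) - gradient_energy (u t))"
proof -
  note L2 = in_spaces[OF t]
  have eq: "AE x in lborel. v t x = cis \<theta> * (weak_laplacian (u t) x + power_nonlin \<alpha> (u t) x)"
    using v_eq[OF t]
  proof eventually_elim
    case (elim x)
    have "cis \<theta> * (cis (- \<theta>) * v t x) = v t x" by (simp add: mult.assoc[symmetric] cis_mult)
    then show ?case using elim by simp
  qed
  have "L2_inner (v t) (u t)
      = L2_inner (\<lambda>x. cis \<theta> * (weak_laplacian (u t) x + power_nonlin \<alpha> (u t) x)) (u t)"
    using eq by (intro L2_inner_cong_AE L2_space_add L2_space_cmult L2) auto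
  also have "\<dots> = cis \<theta> * (L2_inner (weak_laplacian (u t)) (u t) + L2_inner (power_nonlin \<alpha> (u t)) (u t))"
    using L2 by (simp add: L2_inner_cmult_left L2_inner_add_left)
  finally show ?thesis
    using L2 by (simp add: weak_laplacian_inner_self power_nonlin_inner_self)
qed

end

text \<open>The estimate is proved for the length of any existence interval, so it applies to every
  time below the maximal one and needs no limit at blow-up.\<close>

lemma solution_on_time_bound:
  assumes \<alpha>: "0 < \<alpha>" and \<theta>: "0 < cos \<theta>" and sol: "solution_on \<alpha> \<theta> u\<^sub>0 T u"
    and neg: "energy \<alpha> u\<^sub>0 < 0"
  shows "T \<le> (L2_norm u\<^sub>0)\<^sup>2 / (\<alpha> * (\<alpha> + 2) * (- energy \<alpha> u\<^sub>0) * cos \<theta>)"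
proof -
  from sol have T: "0 < T" and u0: "u 0 = u\<^sub>0"
    and uC: "C_in {0..T} (C0_space \<inter> H1_space) (\<lambda>f. sup_norm f + H1_norm f) u"
    and uH2: "C_in {0<..<T} H2_space H2_norm u"
    unfolding solution_on_def by blast+
  from sol obtain v where vL2: "C_in {0<..<T} L2_space L2_norm v"
    and veq: "\<And>t. t \<in> {0<..<T} \<Longrightarrow> has_L2_deriv u (v t) t"
      "\<And>t. t \<in> {0<..<T} \<Longrightarrow> AE x in lborel. cis (- \<theta>) * v t x =
              weak_laplacian (u t) x + of_real (cmod (u t x) powr \<alpha>) * u t x"
    unfolding solution_on_def by blast
  have I: "interior_time \<alpha> \<theta> T t u v" if "0 < t" "t < T" for t
    using that by unfold_locales (use \<alpha> uC uH2 vL2 veq in auto)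
  have u0H1: "u\<^sub>0 \<in> H1_space" and u0C0: "u\<^sub>0 \<in> C0_space"
    using uC T u0 by (auto simp: C_in_def)
  let ?J = "\<lambda>t. power_energy \<alpha> (u t) - gradient_energy (u t)"
  have "T \<le> (L2_norm (u 0))\<^sup>2 / (\<alpha> * (\<alpha> + 2) * (- energy \<alpha> (u 0)) * cos \<theta>)"
  proof (rule concavity_blowup_bound[where J = ?J and D = "\<lambda>t. (L2_norm (v t))\<^sup>2"
        and M = "\<lambda>t. (L2_norm (u t))\<^sup>2" and F = "\<lambda>t. - energy \<alpha> (u t)"])
    show "continuous_on {0..T} (\<lambda>t. (L2_norm (u t))\<^sup>2)" by (rule mass_continuous[OF uC])
    show "continuous_on {0..T} (\<lambda>t. - energy \<alpha> (u t))"
      by (intro continuous_on_minus energy_continuous[OF \<alpha> uC])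
    show "0 < - energy \<alpha> (u 0)" using neg u0 by simp
    \<comment> \<open>Zero mass would force the potential part to vanish by Cauchy-Schwarz, leaving
      a nonnegative energy.\<close>
    show "0 < (L2_norm (u 0))\<^sup>2"
    proof (rule ccontr)
      assume "\<not> 0 < (L2_norm (u 0))\<^sup>2"
      then have z: "L2_norm u\<^sub>0 = 0" by (simp add: u0)
      have L2: "u\<^sub>0 \<in> L2_space" by (rule H1_spaceD[OF u0H1])
      have "norm (L2_inner (power_nonlin \<alpha> u\<^sub>0) u\<^sub>0) \<le> L2_norm (power_nonlin \<alpha> u\<^sub>0) * L2_norm u\<^sub>0"
        by (intro L2_Cauchy_Schwarz power_nonlin_C0_L2 u0C0 L2 \<alpha>)
      then have "power_energy \<alpha> u\<^sub>0 = 0" by (simp add: z power_nonlin_inner_self)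
      then show False using neg energy_eq[OF u0H1, of \<alpha>] gradient_energy_nonneg[of u\<^sub>0] by simp
    qed
    fix t assume tt: "0 < t" "t < T"
    interpret interior_time \<alpha> \<theta> T t u v by (rule I[OF tt])
    have "Re (L2_inner (v t) (u t)) = cos \<theta> * ?J t"
      by (simp add: v_inner_u del: of_real_diff)
    then show "((\<lambda>t. (L2_norm (u t))\<^sup>2) has_real_derivative 2 * cos \<theta> * ?J t) (at t)"
      using mass_has_derivative by (simp only: mult.assoc)
    show "((\<lambda>t. - energy \<alpha> (u t)) has_real_derivative cos \<theta> * (L2_norm (v t))\<^sup>2) (at t)"
      using DERIV_minus[OF energy_has_derivative] by simp
    have "energy \<alpha> (u t) = 1 / 2 * gradient_energy (u t) - 1 / (\<alpha> + 2) * power_energy \<alpha> (u t)"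
      using in_spaces(3)[OF t] by (intro energy_eq H2_spaceD)
    \<comment> \<open>The two sides of the wanted inequality differ by \<alpha>/2 times the gradient
      energy, which is nonnegative.\<close>
    then have "(\<alpha> + 2) * (- energy \<alpha> (u t)) = power_energy \<alpha> (u t) - gradient_energy (u t) - \<alpha> / 2 * gradient_energy (u t)"
      using \<alpha> by (simp add: field_simps)
    then show "(\<alpha> + 2) * (- energy \<alpha> (u t)) \<le> ?J t"
      using \<alpha> gradient_energy_nonneg[of "u t"] by (simp add: mult_nonneg_nonneg)
    \<comment> \<open>Taking the modulus removes the phase; the real part would cost a factor
      cos(theta).\<close>
    have "\<bar>?J t\<bar> = norm (L2_inner (v t) (u t))"
      by (simp add: v_inner_u norm_mult del: of_real_diff)
    also have "\<dots> \<le> L2_norm (v t) * L2_norm (u t)"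
      by (intro L2_Cauchy_Schwarz in_spaces t)
    finally have "\<bar>?J t\<bar>\<^sup>2 \<le> (L2_norm (v t) * L2_norm (u t))\<^sup>2" by (intro power_mono) auto
    then show "(?J t)\<^sup>2 \<le> (L2_norm (u t))\<^sup>2 * (L2_norm (v t))\<^sup>2"
      by (simp add: power_mult_distrib mult.commute)
  qed (use \<alpha> \<theta> T in auto)
  then show ?thesis by (simp only: u0)
qed

theorem theorem1p1:
  fixes \<alpha> \<theta> :: real
    and u\<^sub>0 :: "real ^ 'n \<Rightarrow> complex"
    and u :: "real \<Rightarrow> real ^ 'n \<Rightarrow> complex"
    and Tmax :: ereal
  assumes "0 < \<alpha>"
    and "- (pi / 2) < \<theta>" and "\<theta> < pi / 2"
    and "u\<^sub>0 \<in> C0_space \<inter> H1_space"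
    and "maximal_solution \<alpha> \<theta> u\<^sub>0 Tmax u"
    and "energy \<alpha> u\<^sub>0 < 0"
  shows "Tmax < \<infinity> \<and>
    Tmax \<le> ereal ((L2_norm u\<^sub>0)\<^sup>2 / (\<alpha> * (\<alpha> + 2) * (- energy \<alpha> u\<^sub>0) * cos \<theta>))"
proof -
  let ?B = "(L2_norm u\<^sub>0)\<^sup>2 / (\<alpha> * (\<alpha> + 2) * (- energy \<alpha> u\<^sub>0) * cos \<theta>)"
  have cos: "0 < cos \<theta>" using assms(2,3) by (intro cos_gt_zero_pi) auto
  have "0 \<le> \<alpha> * (\<alpha> + 2) * (- energy \<alpha> u\<^sub>0) * cos \<theta>"
    using assms(1,6) cos by (intro mult_nonneg_nonneg) auto
  \<comment> \<open>Nonnegativity of the bound ensures that a time beyond it is positive and hence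
    admissible as the length of an existence interval.\<close>
  then have B: "0 \<le> ?B" by (intro divide_nonneg_nonneg) auto
  have "Tmax \<le> ereal ?B"
  proof (rule ccontr)
    assume "\<not> Tmax \<le> ereal ?B"
    then have "ereal ?B < Tmax" by simp
    \<comment> \<open>A real time strictly between the bound and \<open>Tmax\<close> exists also
      when \<open>Tmax\<close> is infinite, so both cases are refuted together.\<close>
    then obtain T where T: "ereal ?B < ereal T" "ereal T < Tmax"
      using ereal_dense2 by blast
    then have "?B < T" by simp
    then have "0 < T" using B by linarith
    then have "solution_on \<alpha> \<theta> u\<^sub>0 T u"
      using assms(5) T(2) by (simp add: maximal_solution_def)
    from solution_on_time_bound[OF assms(1) cos this assms(6)] \<open>?B < T\<close> show False by linarith
  qed
  moreover from this have "Tmax < \<infinity>" by (rule order.strict_trans1) simp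
  ultimately show ?thesis by blast
qed

end
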